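(* Fix reals $\alpha,\beta,\gamma,\delta\ge0$ with $\alpha+\beta+\gamma+\delta=1$ satisfying $\alpha+\gamma>0$, $\beta>0$, $\delta>0$. Put $D:=1-4(\alpha\gamma+\alpha\delta+\beta\gamma)$, $\mu:=(1-\sqrt D)/2$, $\sigma^2:=(\alpha+\gamma)\beta\delta/D$. Consider $n\to\infty$ along integers $n$ for which $l:=\alpha n$, $m:=(\alpha+\beta)n$, $k:=(\alpha+\gamma)n$ are integers, and let $X$ be distributed according to $p(\cdot\mid n,m,k,l)$. Then \[ \lim_{n\to\infty}\mathbb V\Bigl[\frac{X}{\sqrt n}\Bigr]=\lim_{n\to\infty}\mathbb E\Bigl[\Bigl(\frac{X-n\mu}{\sqrt n}\Bigr)^2\Bigr]=\sigma^2, \] and \[ \mathbb E[X]=n\mu+\phi+o(1),\qquad \phi:=\frac{\sigma^2-\mu}{1-2\mu}. \]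
   Context: For non-negative integers $n,m,k,l$ with $m,k\le n$ and $m+k-n\le l\le\min(m,k)$, let $M:=m-l$, $N:=n-m-k+l$. Let $\mathbb{C}^2$ have orthonormal basis $|0\rangle,|1\rangle$ and give $(\mathbb{C}^2)^{\otimes n}$ the induced Hermitian inner product. Define $|\Xi_{n,m|k,l}\rangle:=|1\rangle^{\otimes l}\otimes|0\rangle^{\otimes(k-l)}\otimes\binom{M+N}{M}^{-1/2}\sum_{I}|I\rangle$, the sum over all $I\in\{0,1\}^{n-k}$ with exactly $M$ ones (where $|i_1\cdots i_r\rangle=|i_1\rangle\otimes\cdots\otimes|i_r\rangle$). $\mathfrak S_n$ acts on $(\mathbb{C}^2)^{\otimes n}$ by permuting tensor factors. For $0\le x\le\lfloor n/2\rfloor$, $\mathsf P_{(n-x,x)}$ is the orthogonal projection onto the isotypic component of the irreducible $\mathfrak S_n$-representation labelled by the partition $(n-x,x)$, and $p(x\mid n,m,k,l):=\langle\Xi_{n,m|k,l}|\mathsf P_{(n-x,x)}|\Xi_{n,m|k,l}\rangle$, a probability mass function on $\{0,\dots,\lfloor n/2\rfloor\}$. *)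

theory Defs
  imports "HOL-Analysis.Analysis" "HOL-Combinatorics.Permutations"
begin

text \<open>Vectors of (C^2)^{tensor n}: functions on bit strings (False = |0>, True = |1>),
  supported on strings of length n; the indicator of w is the basis vector |w>.\<close>

type_synonym qvec = "bool list \<Rightarrow> complex"

definition qspace :: "nat \<Rightarrow> qvec set" where
  "qspace n = {f. \<forall>w. length w \<noteq> n \<longrightarrow> f w = 0}"

text \<open>Left action of a permutation pi of {0..<n} permuting tensor factors:
  pi |w> = |w o pi^-1> (factor j is moved to position pi j).\<close>
definition perm_act :: "nat \<Rightarrow> (nat \<Rightarrow> nat) \<Rightarrow> qvec \<Rightarrow> qvec" where
  "perm_act n \<pi> f = (\<lambda>w. if length w = n then f (map (\<lambda>i. w ! \<pi> i) [0..<n]) else 0)"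

definition cinner :: "nat \<Rightarrow> qvec \<Rightarrow> qvec \<Rightarrow> complex" where
  "cinner n f g = (\<Sum>w\<in>{w::bool list. length w = n}. cnj (f w) * g w)"

definition csubspace :: "('a \<Rightarrow> complex) set \<Rightarrow> bool" where
  "csubspace U \<longleftrightarrow> (\<lambda>_. 0) \<in> U \<and> (\<forall>f\<in>U. \<forall>g\<in>U. (\<lambda>x. f x + g x) \<in> U)
     \<and> (\<forall>c. \<forall>f\<in>U. (\<lambda>x. c * f x) \<in> U)"

definition cspan :: "('a \<Rightarrow> complex) set \<Rightarrow> ('a \<Rightarrow> complex) set" where
  "cspan A = \<Inter>{U. csubspace U \<and> A \<subseteq> U}"

text \<open>Permutation module M^{(n-x,x)}: tabloids identified with their second row, an
  x-subset of {0..<n}; vectors are functions on sets. Left action pi {S} = {pi ` S}.\<close>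
definition tab_act :: "(nat \<Rightarrow> nat) \<Rightarrow> (nat set \<Rightarrow> complex) \<Rightarrow> (nat set \<Rightarrow> complex)" where
  "tab_act \<pi> g = (\<lambda>S. g (inv \<pi> ` S))"

text \<open>Tableau data of shape (n-x,x): column i (i<x) has top entry a i and bottom entry b i;
  all 2x entries distinct and in {0..<n} (the remaining first-row entries are irrelevant).\<close>
definition valid_cols :: "nat \<Rightarrow> nat \<Rightarrow> (nat \<Rightarrow> nat) \<Rightarrow> (nat \<Rightarrow> nat) \<Rightarrow> bool" where
  "valid_cols n x a b \<longleftrightarrow> inj_on a {..<x} \<and> inj_on b {..<x} \<and>
     a ` {..<x} \<inter> b ` {..<x} = {} \<and> a ` {..<x} \<union> b ` {..<x} \<subseteq> {..<n}"

text \<open>Polytabloid e_t = sum over column permutations q of sgn(q) {q t}.\<close>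
definition polytabloid :: "nat \<Rightarrow> (nat \<Rightarrow> nat) \<Rightarrow> (nat \<Rightarrow> nat) \<Rightarrow> (nat set \<Rightarrow> complex)" where
  "polytabloid x a b = (\<lambda>S. \<Sum>E\<in>Pow {..<x}.
      (-1) ^ card E * (if S = a ` E \<union> b ` ({..<x} - E) then 1 else 0))"

definition specht :: "nat \<Rightarrow> nat \<Rightarrow> (nat set \<Rightarrow> complex) set" where
  "specht n x = cspan {polytabloid x a b | a b. valid_cols n x a b}"

definition specht_copy :: "nat \<Rightarrow> nat \<Rightarrow> qvec set \<Rightarrow> bool" where
  "specht_copy n x W \<longleftrightarrow> csubspace W \<and> W \<subseteq> qspace n \<and>
     (\<forall>\<pi>. \<pi> permutes {..<n} \<longrightarrow> (\<forall>f\<in>W. perm_act n \<pi> f \<in> W)) \<and>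
     (\<exists>T. bij_betw T (specht n x) W \<and>
        (\<forall>g\<in>specht n x. \<forall>h\<in>specht n x. \<forall>c d.
            T (\<lambda>S. c * g S + d * h S) = (\<lambda>w. c * T g w + d * T h w)) \<and>
        (\<forall>\<pi>. \<pi> permutes {..<n} \<longrightarrow> (\<forall>g\<in>specht n x. T (tab_act \<pi> g) = perm_act n \<pi> (T g))))"

definition isotypic :: "nat \<Rightarrow> nat \<Rightarrow> qvec set" where
  "isotypic n x = cspan (\<Union>{W. specht_copy n x W})"

definition oproj :: "nat \<Rightarrow> qvec set \<Rightarrow> qvec \<Rightarrow> qvec" where
  "oproj n U v = (THE u. u \<in> U \<and> (\<forall>w\<in>U. cinner n w (\<lambda>y. v y - u y) = 0))"

definition Xi :: "nat \<Rightarrow> nat \<Rightarrow> nat \<Rightarrow> nat \<Rightarrow> qvec" where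
  "Xi n m k l = (\<lambda>w. if length w = n \<and> take l w = replicate l True
       \<and> take (k - l) (drop l w) = replicate (k - l) False
       \<and> length (filter id (drop k w)) = m - l
     then complex_of_real (1 / sqrt (real ((n - k) choose (m - l)))) else 0)"

definition p_pmf :: "nat \<Rightarrow> nat \<Rightarrow> nat \<Rightarrow> nat \<Rightarrow> nat \<Rightarrow> real" where
  "p_pmf n m k l x = Re (cinner n (Xi n m k l) (oproj n (isotypic n x) (Xi n m k l)))"

definition Dpar :: "real \<Rightarrow> real \<Rightarrow> real \<Rightarrow> real \<Rightarrow> real" where
  "Dpar \<alpha> \<beta> \<gamma> \<delta> = 1 - 4 * (\<alpha> * \<gamma> + \<alpha> * \<delta> + \<beta> * \<gamma>)"
definition mupar :: "real \<Rightarrow> real \<Rightarrow> real \<Rightarrow> real \<Rightarrow> real" where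
  "mupar \<alpha> \<beta> \<gamma> \<delta> = (1 - sqrt (Dpar \<alpha> \<beta> \<gamma> \<delta>)) / 2"
definition sigma2par :: "real \<Rightarrow> real \<Rightarrow> real \<Rightarrow> real \<Rightarrow> real" where
  "sigma2par \<alpha> \<beta> \<gamma> \<delta> = (\<alpha> + \<gamma>) * \<beta> * \<delta> / Dpar \<alpha> \<beta> \<gamma> \<delta>"
definition phipar :: "real \<Rightarrow> real \<Rightarrow> real \<Rightarrow> real \<Rightarrow> real" where
  "phipar \<alpha> \<beta> \<gamma> \<delta> = (sigma2par \<alpha> \<beta> \<gamma> \<delta> - mupar \<alpha> \<beta> \<gamma> \<delta>) / (1 - 2 * mupar \<alpha> \<beta> \<gamma> \<delta>)"


text \<open>The law p(. | n, m, k, l) with l = alpha n, m = (alpha+beta) n, k = (alpha+gamma) n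
  (only used for n where these are integers) and its mean.\<close>
definition Pseq :: "real \<Rightarrow> real \<Rightarrow> real \<Rightarrow> nat \<Rightarrow> nat \<Rightarrow> real" where
  "Pseq \<alpha> \<beta> \<gamma> n x = p_pmf n (nat \<lfloor>(\<alpha> + \<beta>) * real n\<rfloor>) (nat \<lfloor>(\<alpha> + \<gamma>) * real n\<rfloor>) (nat \<lfloor>\<alpha> * real n\<rfloor>) x"
definition Eseq :: "real \<Rightarrow> real \<Rightarrow> real \<Rightarrow> nat \<Rightarrow> real" where
  "Eseq \<alpha> \<beta> \<gamma> n = (\<Sum>x\<in>{0..n div 2}. real x * Pseq \<alpha> \<beta> \<gamma> n x)"

end

theory Submission
  imports Defs
begin

text \<open>
  The sum of all transpositions acts on the isotypic component labelled by (n - x, x) as a scalar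
  that, up to an affine change, is the square of Y = (n + 1)/2 - x. Hence the moments of Y^2
  under p are the matrix elements of powers of an explicit operator at the vector Xi. Since Xi is
  invariant under permutations inside {..<l}, {l..<k} and {k..<n}, these are weighted counts of
  closed walks on the profiles (number of zeros in the first block, number of ones in the second
  block): the mean q and the variance v of Y^2 are exact polynomials, and the fourth central moment is
  O(n^6). As q ~ D n^2/4 and v ~ sigma^2 D n^3, expanding the square root around q gives
  E Y = sqrt q - E (Y - sqrt q)^2 / (2 sqrt q) exactly and
  E (Y - sqrt q)^2 = v / (4 q) + O(sqrt n).

  That the components span is sl2 theory: with the raising and lowering operators on functions of
  subsets, the Specht module is the kernel of the lowering operator in weight x.
\<close>

subsection \<open>Raising and lowering operators\<close>

text \<open>\<open>p_pmf\<close> projects onto the span of all equivariant copies of a Specht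
  module, so a component is not given by anything concrete. Two facts control it. On every copy the
  transposition sum is the same scalar, and these scalars differ for distinct x <= n/2, so
  self-adjointness makes the components orthogonal. And Xi lies in their sum: this cannot be read
  off the operator, and it is the reason for identifying the span of the polytabloids with a kernel,
  since vectors of a given weight are built from such kernels by raising. Only then is p a law of
  total mass 1 whose moments are matrix elements. The mean of X is wanted up to o(1) although X has
  order n, and only Y^2, not Y, has tractable moments. In the exact formula for E Y the correction
  is a second moment divided by a quantity of order n, so that moment need only be known up to o(n);
  the same estimate then yields the variance. Positivity of D keeps q of order n^2, away from the
  branch point of the square root.\<close>

definition up :: "nat \<Rightarrow> (nat set \<Rightarrow> complex) \<Rightarrow> nat set \<Rightarrow> complex" where
  "up n f = (\<lambda>S. if S \<subseteq> {..<n} then \<Sum>i\<in>S. f (S - {i}) else 0)"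

definition down :: "nat \<Rightarrow> (nat set \<Rightarrow> complex) \<Rightarrow> nat set \<Rightarrow> complex" where
  "down n f = (\<lambda>S. if S \<subseteq> {..<n} then \<Sum>i\<in>{..<n} - S. f (insert i S) else 0)"

definition weight :: "nat \<Rightarrow> nat \<Rightarrow> (nat set \<Rightarrow> complex) set" where
  "weight n x = {f. \<forall>S. f S \<noteq> 0 \<longrightarrow> S \<subseteq> {..<n} \<and> card S = x}"

lemma weightD: "f \<in> weight n x \<Longrightarrow> f S \<noteq> 0 \<Longrightarrow> S \<subseteq> {..<n} \<and> card S = x"
  by (auto simp: weight_def)

lemma csubspace_weight: "csubspace (weight n x)"
proof -
  have "f \<in> weight n x \<longleftrightarrow> (\<forall>S. \<not> (S \<subseteq> {..<n} \<and> card S = x) \<longrightarrow> f S = 0)" for f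
    by (auto simp: weight_def)
  then show ?thesis by (simp add: csubspace_def)
qed

lemma csubspace_sum:
  assumes "csubspace U" "\<And>i. i \<in> I \<Longrightarrow> f i \<in> U"
  shows "(\<lambda>S. \<Sum>i\<in>I. f i S) \<in> U"
  using assms(2)
proof (induction I rule: infinite_finite_induct)
  case (insert i I)
  then show ?case using assms(1) by (simp add: csubspace_def)
qed (use assms(1) in \<open>auto simp: csubspace_def\<close>)

lemma csubspace_add: "csubspace U \<Longrightarrow> f \<in> U \<Longrightarrow> g \<in> U \<Longrightarrow> (\<lambda>x. f x + g x) \<in> U"
  and csubspace_scale: "csubspace U \<Longrightarrow> f \<in> U \<Longrightarrow> (\<lambda>x. c * f x) \<in> U"
  and csubspace_zero: "csubspace U \<Longrightarrow> (\<lambda>_. 0) \<in> U"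
  by (auto simp: csubspace_def)

lemma csubspace_diff: "csubspace U \<Longrightarrow> f \<in> U \<Longrightarrow> g \<in> U \<Longrightarrow> (\<lambda>x. f x - g x) \<in> U"
  using csubspace_add[of U f "\<lambda>x. (-1) * g x"] csubspace_scale[of U g "-1"] by simp

lemma cspan_least: "csubspace U \<Longrightarrow> A \<subseteq> U \<Longrightarrow> cspan A \<subseteq> U"
  by (auto simp: cspan_def)

lemma cspan_superset: "A \<subseteq> cspan A"
  by (auto simp: cspan_def)

lemma csubspace_cspan: "csubspace (cspan A)"
  by (auto simp: cspan_def csubspace_def)

lemma down_sum: "down n (\<lambda>S. \<Sum>i\<in>I. c i * f i S) = (\<lambda>S. \<Sum>i\<in>I. c i * down n (f i) S)"
  unfolding down_def by (rule ext) (auto simp: sum_distrib_left intro: sum.swap)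

lemma down_diff: "down n (\<lambda>S. f S - g S) = (\<lambda>S. down n f S - down n g S)"
  by (auto simp: down_def sum_subtractf)

lemma up_add: "up n (\<lambda>S. f S + g S) = (\<lambda>S. up n f S + up n g S)"
  by (auto simp: up_def sum.distrib)

lemma down_add: "down n (\<lambda>S. f S + g S) = (\<lambda>S. down n f S + down n g S)"
  by (auto simp: down_def sum.distrib)

lemma up_scale: "up n (\<lambda>S. c * f S) = (\<lambda>S. c * up n f S)"
  by (auto simp: up_def sum_distrib_left)

lemma down_scale: "down n (\<lambda>S. c * f S) = (\<lambda>S. c * down n f S)"
  by (auto simp: down_def sum_distrib_left)

lemma up_zero: "up n (\<lambda>S. 0) = (\<lambda>S. 0)"
  by (auto simp: up_def)

lemma up_pow_scale: "(up n ^^ j) (\<lambda>S. c * f S) = (\<lambda>S. c * (up n ^^ j) f S)"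
  by (induction j) (simp_all add: up_scale)

lemma up_pow_add: "(up n ^^ j) (\<lambda>S. f S + g S) = (\<lambda>S. (up n ^^ j) f S + (up n ^^ j) g S)"
  by (induction j) (simp_all add: up_add)

lemma csubspace_ker_down: "csubspace {f. down n f = (\<lambda>_. 0)}"
  unfolding csubspace_def mem_Collect_eq
  by (auto simp: down_add down_scale) (auto simp: down_def)

lemma up_weight: "f \<in> weight n x \<Longrightarrow> up n f \<in> weight n (Suc x)"
proof -
  assume f: "f \<in> weight n x"
  show ?thesis unfolding weight_def mem_Collect_eq
  proof (intro allI impI)
    fix S assume nz: "up n f S \<noteq> 0"
    then have S: "S \<subseteq> {..<n}" by (auto simp: up_def split: if_splits)
    with nz obtain i where "i \<in> S" "f (S - {i}) \<noteq> 0"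
      by (auto simp: up_def dest: sum.not_neutral_contains_not_neutral)
    moreover have "finite S" using S finite_subset by blast
    ultimately show "S \<subseteq> {..<n} \<and> card S = Suc x"
      using weightD[OF f] S by (metis card.remove)
  qed
qed

lemma down_weight: "f \<in> weight n (Suc x) \<Longrightarrow> down n f \<in> weight n x"
proof -
  assume f: "f \<in> weight n (Suc x)"
  show ?thesis unfolding weight_def mem_Collect_eq
  proof (intro allI impI)
    fix S assume nz: "down n f S \<noteq> 0"
    then have S: "S \<subseteq> {..<n}" by (auto simp: down_def split: if_splits)
    with nz obtain i where "i \<in> {..<n} - S" "f (insert i S) \<noteq> 0"
      by (auto simp: down_def dest: sum.not_neutral_contains_not_neutral)
    moreover have "finite S" using S finite_subset by blast
    ultimately show "S \<subseteq> {..<n} \<and> card S = x"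
      using weightD[OF f, of "insert i S"] S by auto
  qed
qed

lemma up_pow_weight: "f \<in> weight n x \<Longrightarrow> (up n ^^ j) f \<in> weight n (x + j)"
  by (induction j) (simp_all add: up_weight)

text \<open>The off-diagonal part common to \<open>up\<close> after \<open>down\<close> and
  \<open>down\<close> after \<open>up\<close>. It cancels in their commutator, which leaves the sl2
  relation, and it is also the off-diagonal part of the transposition sum.\<close>

definition exchange :: "nat \<Rightarrow> (nat set \<Rightarrow> complex) \<Rightarrow> nat set \<Rightarrow> complex" where
  "exchange n f S = (\<Sum>i\<in>S. \<Sum>j\<in>{..<n} - S. f (insert j (S - {i})))"

lemma up_down:
  assumes "S \<subseteq> {..<n}"
  shows "up n (down n f) S = of_nat (card S) * f S + exchange n f S"
proof -
  have "up n (down n f) S = (\<Sum>i\<in>S. down n f (S - {i}))"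
    using assms by (simp add: up_def)
  also have "\<dots> = (\<Sum>i\<in>S. f S + (\<Sum>j\<in>{..<n} - S. f (insert j (S - {i}))))"
  proof (rule sum.cong[OF refl])
    fix i assume i: "i \<in> S"
    then have *: "{..<n} - (S - {i}) = insert i ({..<n} - S)" using assms by auto
    have "down n f (S - {i}) = (\<Sum>j\<in>insert i ({..<n} - S). f (insert j (S - {i})))"
      using assms by (auto simp: down_def * )
    also have "\<dots> = f S + (\<Sum>j\<in>{..<n} - S. f (insert j (S - {i})))"
      using i by (simp add: insert_absorb)
    finally show "down n f (S - {i}) = \<dots>" .
  qed
  finally show ?thesis by (simp add: sum.distrib exchange_def)
qed

lemma down_up:
  assumes "S \<subseteq> {..<n}"
  shows "down n (up n f) S = of_nat (n - card S) * f S + exchange n f S"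
proof -
  have fin: "finite S" using assms finite_subset by blast
  have "down n (up n f) S = (\<Sum>j\<in>{..<n} - S. up n f (insert j S))"
    using assms by (simp add: down_def)
  also have "\<dots> = (\<Sum>j\<in>{..<n} - S. f S + (\<Sum>i\<in>S. f (insert j (S - {i}))))"
  proof (rule sum.cong[OF refl])
    fix j assume j: "j \<in> {..<n} - S"
    have "up n f (insert j S) = (\<Sum>i\<in>insert j S. f (insert j S - {i}))"
      using assms j by (simp add: up_def)
    also have "\<dots> = f S + (\<Sum>i\<in>S. f (insert j S - {i}))"
      using j fin by simp
    also have "(\<Sum>i\<in>S. f (insert j S - {i})) = (\<Sum>i\<in>S. f (insert j (S - {i})))"
      using j by (intro sum.cong refl arg_cong[of _ _ f]) auto
    finally show "up n f (insert j S) = f S + (\<Sum>i\<in>S. f (insert j (S - {i})))" .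
  qed
  also have "\<dots> = of_nat (n - card S) * f S + (\<Sum>j\<in>{..<n} - S. \<Sum>i\<in>S. f (insert j (S - {i})))"
    using assms fin by (simp add: sum.distrib card_Diff_subset)
  finally show ?thesis unfolding exchange_def by (subst sum.swap)
qed

lemma down_up_weight:
  assumes "f \<in> weight n x"
  shows "down n (up n f) = (\<lambda>S. up n (down n f) S + (of_nat n - 2 * of_nat x) * f S)"
proof
  fix S
  show "down n (up n f) S = up n (down n f) S + (of_nat n - 2 * of_nat x) * f S"
  proof (cases "S \<subseteq> {..<n}")
    case True
    have "card S \<le> n" using card_mono[OF _ True] by simp
    then show ?thesis
      using weightD[OF assms, of S]
      by (cases "f S = 0") (auto simp: up_down[OF True] down_up[OF True] of_nat_diff algebra_simps)
  next
    case False
    then show ?thesis using weightD[OF assms, of S] by (auto simp: up_def down_def)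
  qed
qed

lemma down_up_pow:
  assumes "k \<in> weight n x" "down n k = (\<lambda>_. 0)"
  shows "down n ((up n ^^ Suc j) k) =
           (\<lambda>S. (of_nat (Suc j) * (of_nat n - 2 * of_nat x - of_nat j)) * (up n ^^ j) k S)"
proof (induction j)
  case 0
  then show ?case using down_up_weight[OF assms(1)] assms(2) by (simp add: up_zero)
next
  case (Suc j)
  have "down n ((up n ^^ Suc (Suc j)) k) = down n (up n ((up n ^^ Suc j) k))" by simp
  also have "\<dots> = (\<lambda>S. (of_nat (Suc j) * (of_nat n - 2 * of_nat x - of_nat j)) * (up n ^^ Suc j) k S
      + (of_nat n - 2 * of_nat (x + Suc j)) * (up n ^^ Suc j) k S)"
    unfolding down_up_weight[OF up_pow_weight[OF assms(1)]] Suc up_scale by simp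
  finally show ?case by (auto simp: algebra_simps)
qed

lemma sl2_coeff_nonzero:
  assumes "j + 2 * x \<noteq> n"
  shows "of_nat (Suc j) * (of_nat n - 2 * of_nat x - of_nat j) \<noteq> (0::complex)"
proof -
  have "(of_nat n :: complex) \<noteq> of_nat (j + 2 * x)" using assms of_nat_eq_iff by metis
  moreover have "of_nat n - 2 * of_nat x - of_nat j = of_nat n - (of_nat (j + 2 * x) :: complex)"
    by simp
  ultimately show ?thesis by (metis mult_eq_0_iff of_nat_eq_0_iff nat.distinct(2) right_minus_eq)
qed

text \<open>Lowering takes each power of \<open>up\<close> back to the previous one times a
  coefficient that vanishes only at step i = n - 2 x, so before that step nothing is lost by
  raising.\<close>

lemma up_pow_eq_zeroD:
  assumes "k \<in> weight n x" "down n k = (\<lambda>_. 0)" "\<And>i. i < j \<Longrightarrow> i + 2 * x \<noteq> n"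
    "(up n ^^ j) k = (\<lambda>_. 0)"
  shows "k = (\<lambda>_. 0)"
  using assms(3,4)
proof (induction j)
  case (Suc j)
  have c: "of_nat (Suc j) * (of_nat n - 2 * of_nat x - of_nat j) \<noteq> (0::complex)"
    using sl2_coeff_nonzero Suc.prems(1) by blast
  have "down n ((up n ^^ Suc j) k) = (\<lambda>_. 0)" using Suc.prems(2) by (auto simp: down_def)
  then have "(up n ^^ j) k = (\<lambda>_. 0)"
    unfolding down_up_pow[OF assms(1,2)] using c by (auto simp: fun_eq_iff)
  then show ?case using Suc by auto
qed simp

text \<open>For n < 2 x no coefficient of the string vanishes, yet the power n + 1 of
  \<open>up\<close> would have weight above n and is therefore zero.\<close>

lemma ker_down_trivial:
  assumes "k \<in> weight n x" "down n k = (\<lambda>_. 0)" "n < 2 * x"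
  shows "k = (\<lambda>_. 0)"
proof (rule up_pow_eq_zeroD[OF assms(1,2)])
  show "(up n ^^ Suc n) k = (\<lambda>_. 0)"
  proof
    fix S
    have "S \<subseteq> {..<n} \<Longrightarrow> card S \<le> n" using card_mono[of "{..<n}" S] by simp
    then show "(up n ^^ Suc n) k S = 0"
      using weightD[OF up_pow_weight[OF assms(1), of "Suc n"], of S] by force
  qed
qed (use assms in auto)

text \<open>If \<open>down n f\<close> is already a sum of raised kernel vectors, dividing each by
  its string coefficient and raising once more gives g with \<open>down n g = down n f\<close>, and
  f - g is the new kernel vector. The bound 2 w <= n keeps the coefficients nonzero.\<close>

lemma weight_decomp:
  assumes "f \<in> weight n w" "2 * w \<le> n"
  shows "\<exists>k. (\<forall>x\<le>w. k x \<in> weight n x \<and> down n (k x) = (\<lambda>_. 0)) \<and>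
             f = (\<lambda>S. \<Sum>x\<le>w. (up n ^^ (w - x)) (k x) S)"
  using assms
proof (induction w arbitrary: f)
  case 0
  have "down n f = (\<lambda>_. 0)"
  proof
    fix S
    have "f (insert i S) = 0" if "S \<subseteq> {..<n}" for i
      using weightD[OF 0(1), of "insert i S"] finite_subset[OF that] by auto
    then show "down n f S = 0" by (auto simp: down_def)
  qed
  then show ?case using 0 by (intro exI[of _ "\<lambda>_. f"]) simp
next
  case (Suc w)
  obtain k where k: "\<And>x. x \<le> w \<Longrightarrow> k x \<in> weight n x" "\<And>x. x \<le> w \<Longrightarrow> down n (k x) = (\<lambda>_. 0)"
    and df: "down n f = (\<lambda>S. \<Sum>x\<le>w. (up n ^^ (w - x)) (k x) S)"
    using Suc.IH[OF down_weight[OF Suc.prems(1)]] Suc.prems(2) by auto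
  define d :: "nat \<Rightarrow> complex" where
    "d x = of_nat (Suc (w - x)) * (of_nat n - 2 * of_nat x - of_nat (w - x))" for x
  have d: "d x \<noteq> 0" if "x \<le> w" for x
    unfolding d_def using that Suc.prems(2) by (intro sl2_coeff_nonzero) simp
  define g where "g = (\<lambda>S. \<Sum>x\<le>w. inverse (d x) * (up n ^^ (Suc w - x)) (k x) S)"
  have dg: "down n g = down n f"
    unfolding g_def down_sum df
  proof (rule ext, rule sum.cong[OF refl])
    fix S x assume "x \<in> {..w}"
    then have x: "x \<le> w" by simp
    then have e: "Suc w - x = Suc (w - x)" by simp
    show "inverse (d x) * down n ((up n ^^ (Suc w - x)) (k x)) S = (up n ^^ (w - x)) (k x) S"
      unfolding e down_up_pow[OF k[OF x]] d_def[symmetric] using d[OF x] by simp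
  qed
  have gw: "g \<in> weight n (Suc w)" unfolding g_def
  proof (intro csubspace_sum[OF csubspace_weight] csubspace_scale[OF csubspace_weight])
    fix x assume x: "x \<in> {..w}"
    then show "(up n ^^ (Suc w - x)) (k x) \<in> weight n (Suc w)"
      using up_pow_weight[OF k(1), of x "Suc w - x"] by simp
  qed
  define k' where "k' x = (if x \<le> w then (\<lambda>S. inverse (d x) * k x S) else (\<lambda>S. f S - g S))" for x
  have "k' x \<in> weight n x \<and> down n (k' x) = (\<lambda>_. 0)" if "x \<le> Suc w" for x
  proof (cases "x \<le> w")
    case True
    then show ?thesis using k[OF True] csubspace_scale[OF csubspace_weight]
      by (simp add: k'_def down_scale)
  next
    case False
    then have "x = Suc w" using that by simp
    then show ?thesis using csubspace_diff[OF csubspace_weight Suc.prems(1) gw] dg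
      by (simp add: k'_def down_diff)
  qed
  moreover have "f = (\<lambda>S. \<Sum>x\<le>Suc w. (up n ^^ (Suc w - x)) (k' x) S)"
    by (rule ext) (simp add: k'_def up_pow_scale g_def)
  ultimately show ?case by blast
qed

subsection \<open>The Specht module as a lowering kernel\<close>

text \<open>Makes each term of a polytabloid the image of a single map on the columns, so that
  deleting an element of the set is deleting a column.\<close>

definition transversal :: "(nat \<Rightarrow> nat) \<Rightarrow> (nat \<Rightarrow> nat) \<Rightarrow> nat set \<Rightarrow> nat \<Rightarrow> nat" where
  "transversal a b E i = (if i \<in> E then a i else b i)"

lemma polytabloid_alt:
  "polytabloid x a b S =
     (\<Sum>E\<in>Pow {..<x}. (-1) ^ card E * of_bool (S = transversal a b E ` {..<x}))"
  unfolding polytabloid_def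
proof (rule sum.cong[OF refl])
  fix E assume "E \<in> Pow {..<x}"
  then have "a ` E \<union> b ` ({..<x} - E) = transversal a b E ` {..<x}"
    by (auto simp: transversal_def image_iff)
  then show "(-1) ^ card E * (if S = a ` E \<union> b ` ({..<x} - E) then 1 else 0)
      = (-1 :: complex) ^ card E * of_bool (S = transversal a b E ` {..<x})" by simp
qed

lemma inj_on_transversal: "valid_cols n x a b \<Longrightarrow> inj_on (transversal a b E) {..<x}"
  by (intro inj_onI) (auto simp: valid_cols_def transversal_def disjoint_iff dest: inj_onD split: if_splits)

lemma transversal_subset: "valid_cols n x a b \<Longrightarrow> transversal a b E ` {..<x} \<subseteq> {..<n}"
  unfolding valid_cols_def transversal_def by auto

lemma polytabloid_weight:
  assumes "valid_cols n x a b"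
  shows "polytabloid x a b \<in> weight n x"
  unfolding weight_def mem_Collect_eq
proof (intro allI impI)
  fix S assume "polytabloid x a b S \<noteq> 0"
  then obtain E where "S = transversal a b E ` {..<x}"
    unfolding polytabloid_alt by (force dest: sum.not_neutral_contains_not_neutral)
  then show "S \<subseteq> {..<n} \<and> card S = x"
    using transversal_subset[OF assms] inj_on_transversal[OF assms] by (simp add: card_image)
qed

text \<open>Toggling i in E changes the sign, so the terms cancel in pairs.\<close>

lemma sum_Pow_toggle:
  fixes f :: "nat set \<Rightarrow> complex"
  assumes "i < x" "\<And>E. E \<subseteq> {..<x} \<Longrightarrow> i \<notin> E \<Longrightarrow> f (insert i E) = f E"
  shows "(\<Sum>E\<in>Pow {..<x}. (-1) ^ card E * f E) = 0"
proof -
  have P: "Pow {..<x} = Pow ({..<x} - {i}) \<union> insert i ` Pow ({..<x} - {i})"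
    using assms(1) Pow_insert[of i "{..<x} - {i}"] by (simp add: insert_absorb)
  have inj: "inj_on (insert i) (Pow ({..<x} - {i}))" by (auto simp: inj_on_def)
  have "(\<Sum>E\<in>Pow {..<x}. (-1) ^ card E * f E) = (\<Sum>E\<in>Pow ({..<x} - {i}). (-1) ^ card E * f E)
      + (\<Sum>E\<in>Pow ({..<x} - {i}). (-1) ^ card (insert i E) * f (insert i E))"
    unfolding P by (subst sum.union_disjoint) (auto simp: sum.reindex[OF inj])
  also have "(\<Sum>E\<in>Pow ({..<x} - {i}). (-1) ^ card (insert i E) * f (insert i E))
      = (\<Sum>E\<in>Pow ({..<x} - {i}). - ((-1) ^ card E * f E))"
  proof (rule sum.cong[OF refl])
    fix E assume E: "E \<in> Pow ({..<x} - {i})"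
    then have "finite E" using finite_subset by auto
    moreover have "i \<notin> E" using E by auto
    ultimately show "(-1) ^ card (insert i E) * f (insert i E) = - ((-1) ^ card E * f E)"
      using assms(2)[of E] E by auto
  qed
  finally show ?thesis by (simp add: sum_negf)
qed

text \<open>A set T one element short of a transversal misses the entry of some column i. It does
  not see which entry of that column was chosen, so toggling i in E pairs terms of opposite
  sign.\<close>

lemma down_polytabloid:
  assumes v: "valid_cols n x a b"
  shows "down n (polytabloid x a b) = (\<lambda>_. 0)"
proof
  fix T
  let ?c = "transversal a b"
  show "down n (polytabloid x a b) T = 0"
  proof (cases "T \<subseteq> {..<n}")
    case T: True
    have "down n (polytabloid x a b) T = (\<Sum>y\<in>{..<n} - T. \<Sum>E\<in>Pow {..<x}.
        (-1) ^ card E * of_bool (insert y T = ?c E ` {..<x}))"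
      using T by (simp add: down_def polytabloid_alt)
    also have "\<dots> = (\<Sum>E\<in>Pow {..<x}. (-1) ^ card E *
        (\<Sum>y\<in>{..<n} - T. of_bool (insert y T = ?c E ` {..<x})))"
      unfolding sum_distrib_left by (rule sum.swap)
    also have "\<dots> = (\<Sum>E\<in>Pow {..<x}. (-1) ^ card E *
        (\<Sum>i<x. of_bool (T = ?c E ` ({..<x} - {i}))))"
    proof (rule sum.cong[OF refl], rule arg_cong[of _ _ "(*) _"])
      fix E
      note inj = inj_on_transversal[OF v, of E]
      \<comment> \<open>For y outside T, \<open>insert y T\<close> is the transversal exactly when y
        lies on it and T is what remains without y; all other terms are zero on either side.\<close>
      have "(\<Sum>y\<in>{..<n} - T. of_bool (insert y T = ?c E ` {..<x})) =
          (\<Sum>y\<in>?c E ` {..<x}. of_bool (T = ?c E ` {..<x} - {y}) :: complex)"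
        using transversal_subset[OF v, of E]
        by (intro sum.mono_neutral_cong) auto
      also have "\<dots> = (\<Sum>i<x. of_bool (T = ?c E ` {..<x} - {?c E i}))"
        by (simp add: sum.reindex[OF inj])
      also have "\<dots> = (\<Sum>i<x. of_bool (T = ?c E ` ({..<x} - {i})))"
        by (intro sum.cong refl) (simp add: inj_on_image_set_diff[OF inj])
      finally show "(\<Sum>y\<in>{..<n} - T. of_bool (insert y T = ?c E ` {..<x})) =
          (\<Sum>i<x. of_bool (T = ?c E ` ({..<x} - {i})) :: complex)" .
    qed
    also have "\<dots> = (\<Sum>i<x. \<Sum>E\<in>Pow {..<x}. (-1) ^ card E * of_bool (T = ?c E ` ({..<x} - {i})))"
      unfolding sum_distrib_left by (rule sum.swap)
    also have "\<dots> = 0"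
    proof (rule sum.neutral, rule ballI)
      fix i assume i: "i \<in> {..<x}"
      have e: "?c (insert i E) ` ({..<x} - {i}) = ?c E ` ({..<x} - {i})" for E
        by (auto simp: transversal_def image_iff)
      show "(\<Sum>E\<in>Pow {..<x}. (-1) ^ card E * of_bool (T = ?c E ` ({..<x} - {i}))) = (0 :: complex)"
        by (rule sum_Pow_toggle) (use i in simp, subst e, rule refl)
    qed
    finally show ?thesis .
  qed (simp add: down_def)
qed

lemma csubspace_Int: "csubspace U \<Longrightarrow> csubspace V \<Longrightarrow> csubspace (U \<inter> V)"
  by (auto simp: csubspace_def)

lemma csubspace_specht: "csubspace (specht n x)"
  by (simp add: specht_def csubspace_cspan)

lemma polytabloid_specht: "valid_cols n x a b \<Longrightarrow> polytabloid x a b \<in> specht n x"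
  unfolding specht_def by (rule subsetD[OF cspan_superset]) auto

lemma specht_subset_ker: "specht n x \<subseteq> weight n x \<inter> {f. down n f = (\<lambda>_. 0)}"
  unfolding specht_def
  by (intro cspan_least csubspace_Int csubspace_weight csubspace_ker_down)
     (auto simp: polytabloid_weight down_polytabloid)

lemma specht_mono: "n \<le> n' \<Longrightarrow> specht n x \<subseteq> specht n' x"
  unfolding specht_def
  by (intro cspan_least csubspace_cspan subset_trans[OF _ cspan_superset])
     (fastforce simp: valid_cols_def)

text \<open>A transversal contains n only if it takes the bottom entry of the new column. Then x is
  not in E, and the sign is that of the old term.\<close>

lemma polytabloid_extend:
  assumes v: "valid_cols n x a b" and T: "T \<subseteq> {..<n}" and z: "z < n"
  shows "polytabloid (Suc x) (a(x := z)) (b(x := n)) (insert n T) = polytabloid x a b T"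
proof -
  let ?c = "transversal (a(x := z)) (b(x := n))"
  have inj: "inj_on (insert x) (Pow {..<x})" by (auto simp: inj_on_def)
  have old: "?c E i = transversal a b E i" "?c (insert x E) i = transversal a b E i" if "i < x" for i E
    using that by (auto simp: transversal_def)
  have im: "?c E ` {..<Suc x} = insert n (transversal a b E ` {..<x})"
    "?c (insert x E) ` {..<Suc x} = insert z (transversal a b E ` {..<x})"
    if "E \<subseteq> {..<x}" for E
    using that old by (auto simp: lessThan_Suc transversal_def image_iff)
  have n: "n \<notin> transversal a b E ` {..<x}" for E
    using transversal_subset[OF v, of E] by auto
  have "polytabloid (Suc x) (a(x := z)) (b(x := n)) (insert n T) =
    (\<Sum>E\<in>Pow {..<x}. (-1) ^ card E * of_bool (insert n T = ?c E ` {..<Suc x})) +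
    (\<Sum>E\<in>Pow {..<x}. (-1) ^ card (insert x E) * of_bool (insert n T = ?c (insert x E) ` {..<Suc x}))"
    unfolding polytabloid_alt lessThan_Suc[of x] Pow_insert
    by (subst sum.union_disjoint) (auto simp: sum.reindex[OF inj])
  also have "(\<Sum>E\<in>Pow {..<x}. (-1) ^ card (insert x E) *
      of_bool (insert n T = ?c (insert x E) ` {..<Suc x})) = (0::complex)"
  proof (intro sum.neutral ballI)
    fix E assume "E \<in> Pow {..<x}"
    then have "insert n T \<noteq> ?c (insert x E) ` {..<Suc x}"
      using im(2)[of E] n[of E] z by auto
    then show "(-1) ^ card (insert x E) * of_bool (insert n T = ?c (insert x E) ` {..<Suc x})
        = (0::complex)" by simp
  qed
  also have "(\<Sum>E\<in>Pow {..<x}. (-1) ^ card E * of_bool (insert n T = ?c E ` {..<Suc x})) =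
      polytabloid x a b T"
    unfolding polytabloid_alt
  proof (intro sum.cong refl arg_cong2[of _ _ _ _ "(*)"] arg_cong[of _ _ of_bool])
    fix E assume "E \<in> Pow {..<x}"
    then show "(insert n T = ?c E ` {..<Suc x}) = (T = transversal a b E ` {..<x})"
      using im(1)[of E] n[of E] T by (auto simp: insert_ident)
  qed
  finally show ?thesis by (simp only: add_0_right)
qed

text \<open>The two-row shape with 2 x < n leaves an entry z free; a new column (z, n) extends the tableau.\<close>

lemma specht_extend:
  assumes g: "g \<in> specht n x" and x: "2 * x < n"
  shows "\<exists>h\<in>specht (Suc n) (Suc x). \<forall>T\<subseteq>{..<n}. h (insert n T) = g T"
proof -
  let ?U = "{g. \<exists>h\<in>specht (Suc n) (Suc x). \<forall>T\<subseteq>{..<n}. h (insert n T) = g T}"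
  note sp = csubspace_specht[of "Suc n" "Suc x"]
  have "csubspace ?U" unfolding csubspace_def
  proof (intro conjI ballI allI)
    show "(\<lambda>_. 0) \<in> ?U" using csubspace_zero[OF sp] by (auto intro!: bexI[of _ "\<lambda>_. 0"])
  next
    fix f g assume "f \<in> ?U" "g \<in> ?U"
    then obtain h h' where "h \<in> specht (Suc n) (Suc x)" "\<forall>T\<subseteq>{..<n}. h (insert n T) = f T"
      "h' \<in> specht (Suc n) (Suc x)" "\<forall>T\<subseteq>{..<n}. h' (insert n T) = g T" by auto
    then show "(\<lambda>x. f x + g x) \<in> ?U"
      using csubspace_add[OF sp, of h h'] by (auto intro!: bexI[of _ "\<lambda>x. h x + h' x"])
  next
    fix c f assume "f \<in> ?U"
    then obtain h where "h \<in> specht (Suc n) (Suc x)" "\<forall>T\<subseteq>{..<n}. h (insert n T) = f T" by auto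
    then show "(\<lambda>x. c * f x) \<in> ?U"
      using csubspace_scale[OF sp, of h c] by (auto intro!: bexI[of _ "\<lambda>x. c * h x"])
  qed
  moreover have "polytabloid x a b \<in> ?U" if v: "valid_cols n x a b" for a b
  proof -
    have "card (a ` {..<x} \<union> b ` {..<x}) \<le> x + x"
      by (rule order_trans[OF card_Un_le]) (intro add_mono order_trans[OF card_image_le], auto)
    then have "\<not> {..<n} \<subseteq> a ` {..<x} \<union> b ` {..<x}"
      using card_mono[of "a ` {..<x} \<union> b ` {..<x}" "{..<n}"] x by auto
    then obtain z where z: "z < n" "z \<notin> a ` {..<x}" "z \<notin> b ` {..<x}" by auto
    have aE: "(a(x := z)) ` {..<x} = a ` {..<x}" "(b(x := n)) ` {..<x} = b ` {..<x}" by auto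
    have nn: "n \<notin> a ` {..<x}" "n \<notin> b ` {..<x}" "a ` {..<x} \<subseteq> {..<Suc n}" "b ` {..<x} \<subseteq> {..<Suc n}"
      using v by (auto simp: valid_cols_def subset_iff)
    have i: "inj_on (a(x := z)) {..<x}" "inj_on (b(x := n)) {..<x}"
      using v by (auto simp: valid_cols_def inj_on_def)
    have x': "{..<Suc x} = insert x {..<x}" by auto
    have "inj_on (a(x := z)) {..<Suc x}" "inj_on (b(x := n)) {..<Suc x}"
      unfolding x' inj_on_insert using i z nn aE by auto
    moreover have "(a(x := z)) ` {..<Suc x} = insert z (a ` {..<x})"
      "(b(x := n)) ` {..<Suc x} = insert n (b ` {..<x})"
      unfolding x' image_insert aE by simp_all
    moreover have "a ` {..<x} \<inter> b ` {..<x} = {}" using v by (simp add: valid_cols_def)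
    ultimately have "valid_cols (Suc n) (Suc x) (a(x := z)) (b(x := n))"
      using z nn unfolding valid_cols_def by auto
    then show ?thesis
      using polytabloid_extend[OF v _ z(1)] polytabloid_specht by blast
  qed
  ultimately have "specht n x \<subseteq> ?U"
    unfolding specht_def[of n x] by (intro cspan_least) auto
  then show ?thesis using g by blast
qed

text \<open>Induction on n. The part h1 of a kernel vector on the sets containing n is a kernel
  vector of weight one less, hence a Specht vector, and extends to a Specht vector h' with the same
  part. The difference h - h' lives on subsets of \<open>{..<n}\<close> and is a kernel vector
  there, so the induction hypothesis applies again.\<close>

lemma ker_down_subset_specht:
  assumes "h \<in> weight n w" "down n h = (\<lambda>_. 0)"
  shows "h \<in> specht n w"
  using assms
proof (induction n arbitrary: h w)
  case 0
  show ?case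
  proof (cases w)
    case 0
    have "h S = h {} * polytabloid 0 id id S" for S
      using weightD[OF \<open>h \<in> weight 0 w\<close>, of S] by (auto simp: polytabloid_def)
    then have "h = (\<lambda>S. h {} * polytabloid 0 id id S)" by blast
    then show ?thesis
      using csubspace_scale[OF csubspace_specht polytabloid_specht[of 0 0 id id]] 0
      by (metis valid_cols_def lessThan_0 image_empty inj_on_empty Int_empty_left Un_empty order_refl)
  next
    case (Suc x)
    then have "h = (\<lambda>_. 0)" using ker_down_trivial[OF 0] by simp
    then show ?thesis by (simp add: csubspace_zero csubspace_specht)
  qed
next
  case (Suc n)
  note h = Suc.prems
  \<comment> \<open>In the third case 2 w <= n + 1, that is 2 x < n: the room for a free entry that
    \<open>specht_extend\<close> asks for.\<close>
  consider "Suc n < 2 * w" | "w = 0" | x where "w = Suc x" "2 * x < n"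
    by (cases w) fastforce+
  then show ?case
  proof cases
    case 1
    then have "h = (\<lambda>_. 0)" using ker_down_trivial[OF h] by simp
    then show ?thesis by (simp add: csubspace_zero csubspace_specht)
  next
    case 2
    have "h S = h {} * polytabloid 0 id id S" for S
      using weightD[OF h(1), of S] 2 finite_subset[of S "{..<Suc n}"] by (auto simp: polytabloid_def)
    then have "h = (\<lambda>S. h {} * polytabloid 0 id id S)" by blast
    moreover have "valid_cols (Suc n) 0 id id" by (simp add: valid_cols_def)
    ultimately show ?thesis
      using csubspace_scale[OF csubspace_specht polytabloid_specht] 2 by metis
  next
    case 3
    define h1 where "h1 T = (if T \<subseteq> {..<n} then h (insert n T) else 0)" for T
    have "h1 \<in> weight n x" unfolding weight_def mem_Collect_eq
    proof (intro allI impI)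
      fix T assume nz: "h1 T \<noteq> 0"
      then have "T \<subseteq> {..<n}" by (auto simp: h1_def split: if_splits)
      moreover from this have "n \<notin> T" "finite T" using finite_subset by auto
      ultimately show "T \<subseteq> {..<n} \<and> card T = x"
        using nz weightD[OF h(1), of "insert n T"] 3 by (simp add: h1_def)
    qed
    moreover have "down n h1 = (\<lambda>_. 0)"
    proof
      fix T
      show "down n h1 T = 0"
      proof (cases "T \<subseteq> {..<n}")
        case True
        then have e: "{..<Suc n} - insert n T = {..<n} - T" by auto
        \<comment> \<open>At \<open>insert n T\<close> lowering inserts only elements below n, so it
          never leaves the sets containing n.\<close>
        have "down n h1 T = down (Suc n) h (insert n T)"
          using True unfolding down_def e
          by (auto simp: h1_def insert_commute intro!: sum.cong)
        then show ?thesis using h(2) by simp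
      qed (simp add: down_def)
    qed
    ultimately have "h1 \<in> specht n x" by (rule Suc.IH)
    then obtain h' where h': "h' \<in> specht (Suc n) w" "\<And>T. T \<subseteq> {..<n} \<Longrightarrow> h' (insert n T) = h1 T"
      using specht_extend 3 by blast
    define d where "d S = h S - h' S" for S
    have h'k: "h' \<in> weight (Suc n) w" "down (Suc n) h' = (\<lambda>_. 0)"
      using h'(1) specht_subset_ker by auto
    have dw: "d \<in> weight (Suc n) w"
      unfolding d_def using csubspace_diff[OF csubspace_weight h(1) h'k(1)] .
    have dd: "down (Suc n) d = (\<lambda>_. 0)" unfolding d_def down_diff h h'k by simp
    have dn: "d (insert n T) = 0" if "T \<subseteq> {..<n}" for T
      using h'(2)[OF that] that by (simp add: d_def h1_def)
    have "d \<in> weight n w" unfolding weight_def mem_Collect_eq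
    proof (intro allI impI)
      fix S assume nz: "d S \<noteq> 0"
      have "n \<notin> S"
      proof
        assume "n \<in> S"
        then have "S = insert n (S - {n})" by auto
        moreover have "S - {n} \<subseteq> {..<n}" using weightD[OF dw nz] by (auto simp: less_Suc_eq)
        ultimately show False using dn nz by metis
      qed
      then show "S \<subseteq> {..<n} \<and> card S = w" using weightD[OF dw nz] by (auto simp: less_Suc_eq)
    qed
    moreover have "down n d = (\<lambda>_. 0)"
    proof
      fix T
      show "down n d T = 0"
      proof (cases "T \<subseteq> {..<n}")
        case True
        then have e: "{..<Suc n} - T = insert n ({..<n} - T)" by auto
        \<comment> \<open>The only additional term inserts n, where d vanishes.\<close>
        have "down (Suc n) d T = down n d T"
          using True dn[OF True] unfolding down_def e by auto
        then show ?thesis using dd by simp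
      qed (simp add: down_def)
    qed
    ultimately have "d \<in> specht (Suc n) w" using Suc.IH specht_mono[of n "Suc n"] by auto
    then have "(\<lambda>S. d S + h' S) \<in> specht (Suc n) w"
      using h'(1) csubspace_add csubspace_specht by blast
    then show ?thesis by (simp add: d_def)
  qed
qed

lemma specht_eq: "specht n x = weight n x \<inter> {f. down n f = (\<lambda>_. 0)}"
  using specht_subset_ker ker_down_subset_specht by auto

subsection \<open>The Casimir operator and the isotypic decomposition\<close>

definition ones :: "bool list \<Rightarrow> nat set" where
  "ones w = {i. i < length w \<and> w ! i}"

definition emb :: "nat \<Rightarrow> (nat set \<Rightarrow> complex) \<Rightarrow> qvec" where
  "emb n f = (\<lambda>w. if length w = n then f (ones w) else 0)"

text \<open>Complementation reaches the weights above n/2, so that raising never has to cross the middle.\<close>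

definition flip :: "nat \<Rightarrow> (nat set \<Rightarrow> complex) \<Rightarrow> nat set \<Rightarrow> complex" where
  "flip n f = (\<lambda>S. if S \<subseteq> {..<n} then f ({..<n} - S) else 0)"

text \<open>The pairs are ordered and include i = j: on \<open>qspace n\<close> this is n times the
  identity plus twice the sum of the transpositions.\<close>

definition casimir :: "nat \<Rightarrow> qvec \<Rightarrow> qvec" where
  "casimir n f = (\<lambda>w. \<Sum>(i, j)\<in>{..<n} \<times> {..<n}. perm_act n (Transposition.transpose i j) f w)"

text \<open>Equals n plus twice the sum of the contents of the partition (n - x, x), the classical
  scalar of the transposition class sum.\<close>

definition casimir_eig :: "nat \<Rightarrow> nat \<Rightarrow> real" where
  "casimir_eig n x = (real x)\<^sup>2 + (real n - real x)\<^sup>2 - 2 * real x"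

lemma ones_subset: "ones w \<subseteq> {..<length w}"
  by (auto simp: ones_def)

lemma ones_char_list: "S \<subseteq> {..<n} \<Longrightarrow> ones (map (\<lambda>i. i \<in> S) [0..<n]) = S"
  by (auto simp: ones_def)

lemma emb_inject:
  assumes "emb n f = emb n g" "\<And>S. \<not> S \<subseteq> {..<n} \<Longrightarrow> f S = g S"
  shows "f = g"
proof
  fix S
  show "f S = g S"
  proof (cases "S \<subseteq> {..<n}")
    case True
    then show ?thesis using fun_cong[OF assms(1), of "map (\<lambda>i. i \<in> S) [0..<n]"]
      by (simp add: emb_def ones_char_list)
  qed (use assms in simp)
qed

lemma emb_qspace: "emb n f \<in> qspace n"
  by (simp add: emb_def qspace_def)

text \<open>Reading w through \<open>\<pi>\<close> replaces its set of ones by the preimage under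
  \<open>\<pi>\<close>, so the conventions of \<open>perm_act\<close> and \<open>tab_act\<close>
  agree.\<close>

lemma perm_act_emb:
  assumes "\<pi> permutes {..<n}"
  shows "perm_act n \<pi> (emb n f) = emb n (tab_act \<pi> f)"
proof -
  have "ones (map (\<lambda>i. w ! \<pi> i) [0..<n]) = inv \<pi> ` ones w" if "length w = n" for w
  proof -
    have "i \<in> ones (map (\<lambda>i. w ! \<pi> i) [0..<n]) \<longleftrightarrow> \<pi> i \<in> ones w" for i
      using permutes_in_image[OF assms, of i] that by (auto simp: ones_def)
    moreover have "\<pi> i \<in> A \<longleftrightarrow> i \<in> inv \<pi> ` A" for i A
      using permutes_inverses[OF assms] by (metis image_iff)
    ultimately show ?thesis by blast
  qed
  then show ?thesis by (auto simp: perm_act_def emb_def tab_act_def)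
qed

section \<open>Equivariance of the operators under the symmetric group\<close>

context
  fixes \<pi> :: "nat \<Rightarrow> nat" and n :: nat
  assumes perm: "\<pi> permutes {..<n}"
begin

lemma inv_image_subset_iff: "inv \<pi> ` S \<subseteq> {..<n} \<longleftrightarrow> S \<subseteq> {..<n}"
  using permutes_in_image[OF permutes_inv[OF perm]] by auto

lemma inj_inv_perm: "inj (inv \<pi>)"
  using permutes_inj[OF permutes_inv[OF perm]] .

lemma inv_image_Compl: "inv \<pi> ` ({..<n} - S) = {..<n} - inv \<pi> ` S"
  using image_set_diff[OF inj_inv_perm, of "{..<n}" S] permutes_image[OF permutes_inv[OF perm]]
  by simp

lemma tab_act_up: "up n (tab_act \<pi> f) = tab_act \<pi> (up n f)"
proof
  fix S
  have "(\<Sum>i\<in>S. f (inv \<pi> ` (S - {i}))) = (\<Sum>i\<in>inv \<pi> ` S. f (inv \<pi> ` S - {i}))"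
    by (subst sum.reindex) (auto simp: image_set_diff inj_inv_perm intro: inj_on_subset[OF inj_inv_perm])
  then show "up n (tab_act \<pi> f) S = tab_act \<pi> (up n f) S"
    by (simp add: up_def tab_act_def inv_image_subset_iff)
qed

lemma tab_act_down: "down n (tab_act \<pi> f) = tab_act \<pi> (down n f)"
proof
  fix S
  have "(\<Sum>i\<in>{..<n} - S. f (inv \<pi> ` insert i S)) = (\<Sum>i\<in>{..<n} - inv \<pi> ` S. f (insert i (inv \<pi> ` S)))"
    unfolding inv_image_Compl[symmetric]
    by (subst sum.reindex) (auto intro: inj_on_subset[OF inj_inv_perm])
  then show "down n (tab_act \<pi> f) S = tab_act \<pi> (down n f) S"
    by (simp add: down_def tab_act_def inv_image_subset_iff)
qed

lemma tab_act_flip: "flip n (tab_act \<pi> f) = tab_act \<pi> (flip n f)"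
  by (rule ext) (simp add: flip_def tab_act_def inv_image_subset_iff inv_image_Compl)

lemma tab_act_weight: "f \<in> weight n x \<Longrightarrow> tab_act \<pi> f \<in> weight n x"
  using card_image[OF inj_on_subset[OF inj_inv_perm subset_UNIV]]
  by (simp add: weight_def tab_act_def inv_image_subset_iff) (metis inv_image_subset_iff)

lemma tab_act_specht: "f \<in> specht n x \<Longrightarrow> tab_act \<pi> f \<in> specht n x"
  unfolding specht_eq by (auto simp: tab_act_weight tab_act_down) (simp add: tab_act_def)

lemma tab_act_up_pow: "(up n ^^ j) (tab_act \<pi> f) = tab_act \<pi> ((up n ^^ j) f)"
  by (induction j) (simp_all add: tab_act_up)

end

text \<open>Reduces a Specht copy to a linear equivariant operator with trivial kernel on the Specht
  module. Strings see only subsets of \<open>{..<n}\<close>, so \<open>supp\<close> is what makes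
  \<open>emb\<close> lose nothing.\<close>

lemma specht_copyI:
  fixes L :: "(nat set \<Rightarrow> complex) \<Rightarrow> nat set \<Rightarrow> complex"
  assumes lin: "\<And>g h c d. L (\<lambda>S. c * g S + d * h S) = (\<lambda>S. c * L g S + d * L h S)"
    and equiv: "\<And>\<pi> g. \<pi> permutes {..<n} \<Longrightarrow> L (tab_act \<pi> g) = tab_act \<pi> (L g)"
    and supp: "\<And>g S. g \<in> specht n x \<Longrightarrow> \<not> S \<subseteq> {..<n} \<Longrightarrow> L g S = 0"
    and ker: "\<And>g. g \<in> specht n x \<Longrightarrow> L g = (\<lambda>_. 0) \<Longrightarrow> g = (\<lambda>_. 0)"
  shows "specht_copy n x ((\<lambda>g. emb n (L g)) ` specht n x)"
proof -
  let ?T = "\<lambda>g. emb n (L g)" and ?V = "specht n x"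
  have Tlin: "?T (\<lambda>S. c * g S + d * h S) = (\<lambda>w. c * ?T g w + d * ?T h w)" for g h c d
    by (rule ext) (simp add: lin emb_def)
  have inj: "inj_on ?T ?V"
  proof (rule inj_onI)
    fix g h assume gh: "g \<in> ?V" "h \<in> ?V" "?T g = ?T h"
    have "L g = L h"
      by (rule emb_inject[OF gh(3)]) (simp add: supp gh)
    then have "L (\<lambda>S. 1 * g S + (-1) * h S) = (\<lambda>_. 0)" unfolding lin by simp
    moreover have "(\<lambda>S. 1 * g S + (-1) * h S) \<in> ?V"
      using csubspace_diff[OF csubspace_specht gh(1,2)] by simp
    ultimately have "(\<lambda>S. 1 * g S + (-1) * h S) = (\<lambda>_. 0)" using ker by blast
    then show "g = h" by (simp add: fun_eq_iff)
  qed
  have "csubspace (?T ` ?V)" unfolding csubspace_def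
  proof (intro conjI ballI allI)
    have "?T (\<lambda>S. 0) = (\<lambda>_. 0)" using Tlin[of 0 _ 0] by simp
    then show "(\<lambda>_. 0) \<in> ?T ` ?V" using csubspace_zero[OF csubspace_specht] by force
  next
    fix f f' assume "f \<in> ?T ` ?V" "f' \<in> ?T ` ?V"
    then obtain g g' where "g \<in> ?V" "g' \<in> ?V" "f = ?T g" "f' = ?T g'" by blast
    then show "(\<lambda>x. f x + f' x) \<in> ?T ` ?V"
      using Tlin[of 1 g 1 g'] csubspace_add[OF csubspace_specht, of g n x g']
      by (auto intro!: image_eqI[of _ _ "\<lambda>S. g S + g' S"])
  next
    fix c f assume "f \<in> ?T ` ?V"
    then obtain g where "g \<in> ?V" "f = ?T g" by blast
    then show "(\<lambda>x. c * f x) \<in> ?T ` ?V"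
      using Tlin[of c g 0 g] csubspace_scale[OF csubspace_specht, of g n x c]
      by (auto intro!: image_eqI[of _ _ "\<lambda>S. c * g S"])
  qed
  moreover have Tact: "?T (tab_act \<pi> g) = perm_act n \<pi> (?T g)" if "\<pi> permutes {..<n}" for \<pi> g
    by (simp add: perm_act_emb equiv that)
  moreover have "perm_act n \<pi> f \<in> ?T ` ?V" if p: "\<pi> permutes {..<n}" and f: "f \<in> ?T ` ?V" for \<pi> f
  proof -
    obtain g where "g \<in> ?V" "f = ?T g" using f by blast
    then show ?thesis using Tact[OF p, of g] tab_act_specht[OF p] by (metis imageI)
  qed
  ultimately show ?thesis
    unfolding specht_copy_def using inj Tlin emb_qspace
    by (intro conjI) (auto simp: inj_on_imp_bij_betw intro!: exI[of _ ?T])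
qed

section \<open>Decomposing a weight space into isotypic parts\<close>

lemma isotypic_specht_copy: "specht_copy n x W \<Longrightarrow> f \<in> W \<Longrightarrow> f \<in> isotypic n x"
  unfolding isotypic_def by (rule subsetD[OF cspan_superset]) blast

lemma specht_up_pow_ker:
  assumes "g \<in> specht n x" "(up n ^^ j) g = (\<lambda>_. 0)" "2 * x + j \<le> n"
  shows "g = (\<lambda>_. 0)"
  using assms by (intro up_pow_eq_zeroD[of g n x j]) (auto simp: specht_eq)

lemma flip_flip: "(\<And>S. \<not> S \<subseteq> {..<n} \<Longrightarrow> f S = 0) \<Longrightarrow> flip n (flip n f) = f"
  by (rule ext) (auto simp: flip_def double_diff)

lemma up_pow_supp: "g \<in> specht n x \<Longrightarrow> \<not> S \<subseteq> {..<n} \<Longrightarrow> (up n ^^ j) g S = 0"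
  using weightD[OF up_pow_weight[of g n x j], of S] by (auto simp: specht_eq)

lemma flip_linear: "flip n (\<lambda>S. c * g S + d * h S) = (\<lambda>S. c * flip n g S + d * flip n h S)"
  by (auto simp: flip_def)

lemma flip_sum: "flip n (\<lambda>S. \<Sum>i\<in>I. g i S) = (\<lambda>S. \<Sum>i\<in>I. flip n (g i) S)"
  by (auto simp: flip_def)

lemma flip_outside: "\<not> S \<subseteq> {..<n} \<Longrightarrow> flip n f S = 0"
  by (simp add: flip_def)

text \<open>\<open>up\<close> commutes with permutations, and its powers up to n - 2 x are injective
  on the Specht module, so every image is a copy. Complementation is an equivariant involution and
  gives the second family.\<close>

lemma emb_up_pow_isotypic:
  assumes g: "g \<in> specht n x" and j: "2 * x + j \<le> n"
  shows "emb n ((up n ^^ j) g) \<in> isotypic n x" "emb n (flip n ((up n ^^ j) g)) \<in> isotypic n x"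
proof -
  have "specht_copy n x ((\<lambda>g. emb n ((up n ^^ j) g)) ` specht n x)"
    by (rule specht_copyI)
      (auto simp: up_pow_add up_pow_scale tab_act_up_pow up_pow_supp intro: specht_up_pow_ker j)
  then show "emb n ((up n ^^ j) g) \<in> isotypic n x"
    using g by (auto elim: isotypic_specht_copy)
  have "specht_copy n x ((\<lambda>g. emb n (flip n ((up n ^^ j) g))) ` specht n x)"
  proof (rule specht_copyI)
    fix g assume g: "g \<in> specht n x" and z: "flip n ((up n ^^ j) g) = (\<lambda>_. 0)"
    have "(up n ^^ j) g = flip n (flip n ((up n ^^ j) g))"
      using up_pow_supp[OF g] by (simp add: flip_flip)
    also have "\<dots> = (\<lambda>_. 0)" unfolding z by (auto simp: flip_def)
    finally show "g = (\<lambda>_. 0)" using specht_up_pow_ker[OF g] j by blast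
  qed (simp_all add: up_pow_add up_pow_scale tab_act_up_pow tab_act_flip flip_linear flip_outside)
  then show "emb n (flip n ((up n ^^ j) g)) \<in> isotypic n x"
    using g by (auto elim: isotypic_specht_copy)
qed

lemma flip_weight: "f \<in> weight n m \<Longrightarrow> flip n f \<in> weight n (n - m)"
  unfolding weight_def mem_Collect_eq
proof (intro allI impI)
  fix S assume f: "\<forall>S. f S \<noteq> 0 \<longrightarrow> S \<subseteq> {..<n} \<and> card S = m" and nz: "flip n f S \<noteq> 0"
  then have S: "S \<subseteq> {..<n}" "card ({..<n} - S) = m" by (auto simp: flip_def split: if_splits)
  then have "n - card S = m" "card S \<le> n"
    using card_Diff_subset[of S "{..<n}"] finite_subset[of S "{..<n}"] card_mono[of "{..<n}" S] by auto
  then show "S \<subseteq> {..<n} \<and> card S = n - m" using S by auto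
qed

lemma isotypic_zero: "(\<lambda>_. 0) \<in> isotypic n x"
  unfolding isotypic_def by (rule csubspace_zero[OF csubspace_cspan])

text \<open>Supplies components for Xi; that they are its projections follows later from
  orthogonality.\<close>

lemma isotypic_decomp:
  assumes f: "f \<in> weight n m" and m: "m \<le> n"
  shows "\<exists>u. (\<forall>x. u x \<in> isotypic n x) \<and> emb n f = (\<lambda>w. \<Sum>x\<le>n div 2. u x w)"
proof (cases "2 * m \<le> n")
  case True
  then obtain k where k: "\<And>x. x \<le> m \<Longrightarrow> k x \<in> specht n x"
    and fk: "f = (\<lambda>S. \<Sum>x\<le>m. (up n ^^ (m - x)) (k x) S)"
    using weight_decomp[OF f] by (auto simp: specht_eq)
  define u where "u x = (if x \<le> m then emb n ((up n ^^ (m - x)) (k x)) else (\<lambda>_. 0))" for x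
  have "u x \<in> isotypic n x" for x
    using emb_up_pow_isotypic(1)[OF k, of x "m - x"] True by (auto simp: u_def isotypic_zero)
  moreover have "emb n f w = (\<Sum>x\<le>n div 2. u x w)" for w
  proof -
    have "emb n f w = (\<Sum>x\<le>m. u x w)" by (subst fk) (simp add: emb_def u_def)
    also have "\<dots> = (\<Sum>x\<le>n div 2. u x w)"
      using True by (intro sum.mono_neutral_left) (auto simp: u_def)
    finally show ?thesis .
  qed
  ultimately show ?thesis by blast
next
  case False
  define m' where "m' = n - m"
  have m': "2 * m' \<le> n" using False by (simp add: m'_def)
  have "flip n f \<in> weight n m'" unfolding m'_def using f by (rule flip_weight)
  then obtain k where k: "\<And>x. x \<le> m' \<Longrightarrow> k x \<in> specht n x"
    and fk: "flip n f = (\<lambda>S. \<Sum>x\<le>m'. (up n ^^ (m' - x)) (k x) S)"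
    using weight_decomp[OF _ m'] by (auto simp: specht_eq)
  have "flip n (flip n f) = f" using f by (intro flip_flip) (auto simp: weight_def)
  then have fk': "f = (\<lambda>S. \<Sum>x\<le>m'. flip n ((up n ^^ (m' - x)) (k x)) S)"
    unfolding fk flip_sum by (rule sym)
  define u where "u x = (if x \<le> m' then emb n (flip n ((up n ^^ (m' - x)) (k x))) else (\<lambda>_. 0))" for x
  have "u x \<in> isotypic n x" for x
    using emb_up_pow_isotypic(2)[OF k, of x "m' - x"] m' by (auto simp: u_def isotypic_zero)
  moreover have "emb n f w = (\<Sum>x\<le>n div 2. u x w)" for w
  proof -
    have "emb n f w = (\<Sum>x\<le>m'. u x w)" by (subst fk') (simp add: emb_def u_def)
    also have "\<dots> = (\<Sum>x\<le>n div 2. u x w)"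
      using m' by (intro sum.mono_neutral_left) (auto simp: u_def)
    finally show ?thesis .
  qed
  ultimately show ?thesis by blast
qed

section \<open>The scalar by which the transposition sum acts\<close>

lemma sum_transpose_exchange:
  assumes S: "S \<subseteq> {..<n}"
  shows "(\<Sum>(i, j)\<in>{..<n} \<times> {..<n}. f (Transposition.transpose i j ` S)) =
     ((of_nat (card S))\<^sup>2 + (of_nat n - of_nat (card S))\<^sup>2) * f S + 2 * exchange n f S"
proof -
  let ?C = "{..<n} - S"
  have fin: "finite S" using S finite_subset by blast
  have D: "{..<n} = S \<union> ?C" using S by auto
  have split: "(\<Sum>i<n. g i) = sum g S + sum g ?C" for g :: "nat \<Rightarrow> complex"
    by (subst D, subst sum.union_disjoint) (auto simp: fin)
  \<comment> \<open>Pairs within S or within its complement fix S and give the two squares; a mixed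
    pair occurs in both orders, whence the factor 2 of \<open>exchange\<close>.\<close>
  have in_in: "Transposition.transpose i j ` S = S" if "(i \<in> S) = (j \<in> S)" for i j
    using that by (auto simp: transpose_image_eq)
  have in_out: "Transposition.transpose i j ` S = insert j (S - {i})" "Transposition.transpose j i ` S = insert j (S - {i})"
    if "i \<in> S" "j \<in> ?C" for i j
    using that by (auto simp: Transposition.transpose_def image_iff)
  have "(\<Sum>(i, j)\<in>{..<n} \<times> {..<n}. f (Transposition.transpose i j ` S)) = (\<Sum>i<n. \<Sum>j<n. f (Transposition.transpose i j ` S))"
    by (simp add: sum.cartesian_product)
  also have "\<dots> = (\<Sum>i\<in>S. \<Sum>j\<in>S. f (Transposition.transpose i j ` S)) + (\<Sum>i\<in>S. \<Sum>j\<in>?C. f (Transposition.transpose i j ` S))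
     + ((\<Sum>i\<in>?C. \<Sum>j\<in>S. f (Transposition.transpose i j ` S)) + (\<Sum>i\<in>?C. \<Sum>j\<in>?C. f (Transposition.transpose i j ` S)))"
    by (simp add: split sum.distrib)
  also have "(\<Sum>i\<in>S. \<Sum>j\<in>S. f (Transposition.transpose i j ` S)) = (of_nat (card S))\<^sup>2 * f S"
    by (simp add: in_in power2_eq_square)
  also have "(\<Sum>i\<in>?C. \<Sum>j\<in>?C. f (Transposition.transpose i j ` S)) = (of_nat (card ?C))\<^sup>2 * f S"
    by (simp add: in_in power2_eq_square)
  also have "(\<Sum>i\<in>S. \<Sum>j\<in>?C. f (Transposition.transpose i j ` S)) = exchange n f S"
    unfolding exchange_def by (intro sum.cong refl) (simp add: in_out)
  also have "(\<Sum>i\<in>?C. \<Sum>j\<in>S. f (Transposition.transpose i j ` S)) = exchange n f S"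
    unfolding exchange_def by (subst sum.swap, intro sum.cong refl) (simp add: in_out)
  also have "(of_nat (card ?C) :: complex) = of_nat n - of_nat (card S)"
    using card_mono[OF _ S] by (simp add: card_Diff_subset fin S of_nat_diff)
  finally show ?thesis by (simp add: algebra_simps)
qed

lemma transpose_permutes: "i < n \<Longrightarrow> j < n \<Longrightarrow> Transposition.transpose i j permutes {..<n}"
  by (rule permutes_swap_id) auto

lemma casimir_emb:
  "casimir n (emb n f) = emb n (\<lambda>S. \<Sum>(i, j)\<in>{..<n} \<times> {..<n}. f (Transposition.transpose i j ` S))"
proof
  fix w
  have "casimir n (emb n f) w = (\<Sum>(i, j)\<in>{..<n} \<times> {..<n}. emb n (tab_act (Transposition.transpose i j) f) w)"
    unfolding casimir_def by (intro sum.cong refl) (auto simp: perm_act_emb transpose_permutes)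
  then show "casimir n (emb n f) w = emb n (\<lambda>S. \<Sum>(i, j)\<in>{..<n} \<times> {..<n}. f (Transposition.transpose i j ` S)) w"
    by (auto simp: emb_def tab_act_def intro!: sum.cong)
qed

text \<open>On the kernel of \<open>down\<close> the composite \<open>up n (down n g)\<close> is
  zero, which forces \<open>exchange\<close> to act as minus the cardinality x; twice this and the
  two squares make up the eigenvalue.\<close>

lemma specht_casimir:
  assumes g: "g \<in> specht n x"
  shows "(\<Sum>(i, j)\<in>{..<n} \<times> {..<n}. tab_act (Transposition.transpose i j) g S) = of_real (casimir_eig n x) * g S"
proof (cases "S \<subseteq> {..<n}")
  case True
  have d: "down n g = (\<lambda>_. 0)" and w: "g \<in> weight n x" using g by (auto simp: specht_eq)
  have "up n (down n g) S = 0" unfolding d by (simp add: up_zero)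
  then have e: "exchange n g S = - of_nat (card S) * g S"
    using up_down[OF True, of g] by (simp add: eq_neg_iff_add_eq_0 add.commute)
  have "(\<Sum>(i, j)\<in>{..<n} \<times> {..<n}. tab_act (Transposition.transpose i j) g S) =
      ((of_nat (card S))\<^sup>2 + (of_nat n - of_nat (card S))\<^sup>2 - 2 * of_nat (card S)) * g S"
    using sum_transpose_exchange[OF True, of g] by (simp add: tab_act_def e algebra_simps)
  then show ?thesis using weightD[OF w, of S] by (cases "g S = 0") (auto simp: casimir_eig_def)
next
  case False
  have z: "g S = 0" if "\<not> S \<subseteq> {..<n}" for S using that g by (auto simp: specht_eq weight_def)
  have "tab_act (Transposition.transpose i j) g S = 0" if "i < n" "j < n" for i j
    unfolding tab_act_def
    using inv_image_subset_iff[OF transpose_permutes[OF that], of S] False by (intro z) simp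
  then show ?thesis using z[OF False] by (auto intro!: sum.neutral)
qed

lemma linear_on_sum:
  assumes V: "csubspace V"
    and lin: "\<And>g h c d. g \<in> V \<Longrightarrow> h \<in> V \<Longrightarrow> T (\<lambda>S. c * g S + d * h S) = (\<lambda>w. c * T g w + d * T h w)"
    and I: "finite I" "\<And>i. i \<in> I \<Longrightarrow> G i \<in> V"
  shows "T (\<lambda>S. \<Sum>i\<in>I. G i S) = (\<lambda>w. \<Sum>i\<in>I. (T (G i) w :: complex))"
  using I
proof (induction I)
  case empty
  then show ?case using lin[OF csubspace_zero[OF V] csubspace_zero[OF V], of 0 0] by simp
next
  case (insert i I)
  then show ?case
    using lin[of "G i" "\<lambda>S. \<Sum>i\<in>I. G i S" 1 1] csubspace_sum[OF V, of I G] by simp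
qed

text \<open>The scalar is expressed by the group action alone, so the equivariant bijection
  \<open>T\<close> carries it to every copy W, wherever W sits in the tensor space.\<close>

lemma specht_copy_casimir:
  assumes "specht_copy n x W" "f \<in> W"
  shows "casimir n f = (\<lambda>w. of_real (casimir_eig n x) * f w)"
proof -
  obtain T where bij: "bij_betw T (specht n x) W"
    and lin: "\<And>g h c d. g \<in> specht n x \<Longrightarrow> h \<in> specht n x \<Longrightarrow>
       T (\<lambda>S. c * g S + d * h S) = (\<lambda>w. c * T g w + d * T h w)"
    and act: "\<And>\<pi> g. \<pi> permutes {..<n} \<Longrightarrow> g \<in> specht n x \<Longrightarrow> T (tab_act \<pi> g) = perm_act n \<pi> (T g)"
    using assms(1) unfolding specht_copy_def by auto
  obtain g where g: "g \<in> specht n x" "f = T g"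
    using bij assms(2) by (auto simp: bij_betw_def)
  let ?I = "{..<n} \<times> {..<n}"
  let ?G = "\<lambda>p. tab_act (Transposition.transpose (fst p) (snd p)) g"
  have "casimir n f = (\<lambda>w. \<Sum>p\<in>?I. T (?G p) w)"
    unfolding casimir_def
    by (intro ext sum.cong refl) (auto simp: act[OF transpose_permutes g(1)] g(2))
  also have "\<dots> = T (\<lambda>S. \<Sum>p\<in>?I. ?G p S)"
    by (rule linear_on_sum[OF csubspace_specht lin, symmetric])
       (auto intro!: tab_act_specht transpose_permutes g(1))
  also have "(\<lambda>S. \<Sum>p\<in>?I. ?G p S) = (\<lambda>S. of_real (casimir_eig n x) * g S)"
    using specht_casimir[OF g(1)] by (simp add: case_prod_unfold)
  also have "T \<dots> = (\<lambda>w. of_real (casimir_eig n x) * T g w)"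
    using lin[OF g(1) g(1), of "of_real (casimir_eig n x)" 0] by simp
  finally show ?thesis by (simp add: g(2))
qed

section \<open>Isotypic components as orthogonal eigenspaces\<close>

lemma casimir_add: "casimir n (\<lambda>w. f w + g w) = (\<lambda>w. casimir n f w + casimir n g w)"
proof -
  have "perm_act n \<pi> (\<lambda>w. f w + g w) w = perm_act n \<pi> f w + perm_act n \<pi> g w" for \<pi> w
    by (simp add: perm_act_def)
  then show ?thesis by (simp add: casimir_def case_prod_unfold sum.distrib)
qed

lemma casimir_scale: "casimir n (\<lambda>w. c * f w) = (\<lambda>w. c * casimir n f w)"
proof -
  have "perm_act n \<pi> (\<lambda>w. c * f w) w = c * perm_act n \<pi> f w" for \<pi> w
    by (simp add: perm_act_def)
  then show ?thesis by (simp add: casimir_def case_prod_unfold sum_distrib_left)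
qed

lemma casimir_zero: "casimir n (\<lambda>w. 0) = (\<lambda>w. 0)"
  using casimir_scale[of n 0 "\<lambda>_. 0"] by simp

lemma isotypic_casimir:
  assumes "f \<in> isotypic n x"
  shows "casimir n f = (\<lambda>w. of_real (casimir_eig n x) * f w)"
proof -
  let ?U = "{f. casimir n f = (\<lambda>w. of_real (casimir_eig n x) * f w)}"
  have "csubspace ?U"
    by (auto simp: csubspace_def casimir_add casimir_scale casimir_zero algebra_simps)
  then have "isotypic n x \<subseteq> ?U"
    unfolding isotypic_def by (rule cspan_least) (auto simp: specht_copy_casimir)
  then show ?thesis using assms by auto
qed

lemma isotypic_qspace: "isotypic n x \<subseteq> qspace n"
  unfolding isotypic_def
proof (rule cspan_least)
  show "csubspace (qspace n)" by (auto simp: csubspace_def qspace_def)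
  show "\<Union> {W. specht_copy n x W} \<subseteq> qspace n"
    unfolding specht_copy_def by (intro Union_least) blast
qed

lemma cinner_perm_act:
  assumes "i < n" "j < n"
  shows "cinner n (perm_act n (Transposition.transpose i j) f) g = cinner n f (perm_act n (Transposition.transpose i j) g)"
proof -
  let ?P = "\<lambda>w :: bool list. map (\<lambda>l. w ! Transposition.transpose i j l) [0..<n]"
  have lt: "Transposition.transpose i j l < n" if "l < n" for l
    using assms that by (auto simp: Transposition.transpose_def)
  have PP: "?P (?P w) = w" if "length w = n" for w
    using that lt by (intro nth_equalityI) auto
  show ?thesis unfolding cinner_def
    by (rule sum.reindex_bij_witness[of _ ?P ?P]) (auto simp: perm_act_def PP)
qed

lemma cinner_sum_right: "cinner n f (\<lambda>w. \<Sum>i\<in>I. g i w) = (\<Sum>i\<in>I. cinner n f (g i))"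
  unfolding cinner_def sum_distrib_left by (rule sum.swap)

lemma cinner_sum_left: "cinner n (\<lambda>w. \<Sum>i\<in>I. g i w) f = (\<Sum>i\<in>I. cinner n (g i) f)"
  unfolding cinner_def cnj_sum sum_distrib_right by (rule sum.swap)

lemma cinner_scale_right: "cinner n f (\<lambda>w. c * g w) = c * cinner n f g"
  by (simp add: cinner_def sum_distrib_left mult_ac)

lemma cinner_scale_left: "cinner n (\<lambda>w. c * f w) g = cnj c * cinner n f g"
  by (simp add: cinner_def sum_distrib_left mult_ac)

lemma cinner_casimir: "cinner n (casimir n f) g = cinner n f (casimir n g)"
  unfolding casimir_def case_prod_unfold cinner_sum_left cinner_sum_right
  by (intro sum.cong refl) (auto simp: cinner_perm_act)

text \<open>As a function of x the eigenvalue is a parabola with vertex (n + 1)/2, hence injective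
  on x <= n/2.\<close>

lemma casimir_eig_inj:
  assumes "x \<le> n div 2" "y \<le> n div 2" "casimir_eig n x = casimir_eig n y"
  shows "x = y"
proof -
  have "(real x - real y) * (real x + real y - real n - 1) = 0"
    using assms(3) by (simp add: casimir_eig_def power2_eq_square algebra_simps)
  moreover have "real x + real y - real n - 1 < 0" using assms(1,2) by linarith
  ultimately show ?thesis by simp
qed

lemma isotypic_orthogonal:
  assumes "f \<in> isotypic n x" "g \<in> isotypic n y" "x \<le> n div 2" "y \<le> n div 2" "x \<noteq> y"
  shows "cinner n f g = 0"
proof -
  have "of_real (casimir_eig n x) * cinner n f g = of_real (casimir_eig n y) * cinner n f g"
    using cinner_casimir[of n f g]
    by (simp add: isotypic_casimir[OF assms(1)] isotypic_casimir[OF assms(2)]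
          cinner_scale_left cinner_scale_right)
  then show ?thesis using casimir_eig_inj[OF assms(3,4)] assms(5) by auto
qed

lemma finite_bool_lists: "finite {w :: bool list. length w = n}"
  using finite_lists_length_eq[of "UNIV :: bool set" n] by simp

lemma cinner_self_eq_0:
  assumes "f \<in> qspace n" "cinner n f f = 0"
  shows "f = (\<lambda>_. 0)"
proof
  fix w
  have "cinner n f f = of_real (\<Sum>w | length w = n. (cmod (f w))\<^sup>2)"
    unfolding cinner_def of_real_sum
    by (intro sum.cong refl) (metis complex_norm_square mult.commute of_real_power)
  then have "(\<Sum>w | length w = n. (cmod (f w))\<^sup>2) = 0" using assms(2) of_real_eq_0_iff by metis
  then have "\<forall>w\<in>{w. length w = n}. (cmod (f w))\<^sup>2 = 0"
    by (subst (asm) sum_nonneg_eq_0_iff) (auto simp: finite_bool_lists)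
  then show "f w = 0" using assms(1) by (cases "length w = n") (auto simp: qspace_def)
qed

text \<open>Orthogonality makes the rest of v orthogonal to component x. Two candidates for the
  projection differ by a vector of the component that is orthogonal to itself, so the
  \<open>THE\<close> in \<open>oproj\<close> is well defined.\<close>

lemma oproj_isotypic:
  assumes u: "\<And>x. x \<le> n div 2 \<Longrightarrow> u x \<in> isotypic n x" and v: "v = (\<lambda>w. \<Sum>x\<le>n div 2. u x w)"
    and x: "x \<le> n div 2"
  shows "oproj n (isotypic n x) v = u x"
  unfolding oproj_def
proof (rule the_equality)
  have vu: "(\<lambda>y. v y - u x y) = (\<lambda>w. \<Sum>y\<in>{..n div 2} - {x}. u y w)"
    using x by (auto simp: v sum.remove[of "{..n div 2}" x])
  show P: "u x \<in> isotypic n x \<and> (\<forall>w\<in>isotypic n x. cinner n w (\<lambda>y. v y - u x y) = 0)"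
    unfolding vu cinner_sum_right using u x isotypic_orthogonal[OF _ u x]
    by (auto intro!: sum.neutral)
  fix z assume z: "z \<in> isotypic n x \<and> (\<forall>w\<in>isotypic n x. cinner n w (\<lambda>y. v y - z y) = 0)"
  let ?d = "\<lambda>y. u x y - z y"
  have d: "?d \<in> isotypic n x"
    using P z unfolding isotypic_def by (intro csubspace_diff[OF csubspace_cspan]) auto
  have "cinner n ?d ?d = cinner n ?d (\<lambda>y. v y - z y) - cinner n ?d (\<lambda>y. v y - u x y)"
    unfolding cinner_def by (simp add: algebra_simps flip: sum_subtractf)
  then have "cinner n ?d ?d = 0" using d P z by simp
  then have "?d = (\<lambda>_. 0)" using cinner_self_eq_0 d isotypic_qspace by blast
  then show "z = u x" by (simp add: fun_eq_iff)
qed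

subsection \<open>Moments as walks on profiles\<close>

text \<open>Half, because \<open>casimir\<close> counts each transposition twice. With the shift
  \<open>center n m k l\<close> it acts on component x as Y^2 - q.\<close>

definition shifted_casimir :: "nat \<Rightarrow> real \<Rightarrow> qvec \<Rightarrow> qvec" where
  "shifted_casimir n \<kappa> f = (\<lambda>w. casimir n f w / 2 - of_real \<kappa> * f w)"

text \<open>A profile (i, j) stands for sets with i elements of {..<l} missing and j elements of {l..<k} present;
  a = l, b = k - l, and M, N are the numbers of ones and zeros of Xi in {k..<n}. The coefficient of a
  shift is the number of ways to move a one from one block to a zero of another; the truncated
  i - 1 and j - 1 at 0 carry the factor 0.\<close>

definition profile_op ::
    "real \<Rightarrow> real \<Rightarrow> real \<Rightarrow> real \<Rightarrow> (nat \<Rightarrow> nat \<Rightarrow> real) \<Rightarrow> nat \<Rightarrow> nat \<Rightarrow> real" where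
  "profile_op a b M N \<phi> i j =
     ((a - i) * i + j * (b - j) + (M + i - j) * (N - i + j) - M * N) * \<phi> i j
     + (a - i) * (N - i + j) * \<phi> (i + 1) j + (M + i - j) * i * \<phi> (i - 1) j
     + (M + i - j) * (b - j) * \<phi> i (j + 1) + j * (N - i + j) * \<phi> i (j - 1)
     + (a - i) * (b - j) * \<phi> (i + 1) (j + 1) + real j * i * \<phi> (i - 1) (j - 1)"

definition delta00 :: "nat \<Rightarrow> nat \<Rightarrow> real" where
  "delta00 i j = (if i = 0 \<and> j = 0 then 1 else 0)"

text \<open>The diagonal matrix element of \<open>casimir\<close> / 2 at Xi: M N counts the
  exchanges inside \<open>{k..<n}\<close>, half the two squares comes from the pairs that fix a set.
  Subtracting it makes the first moment zero.\<close>

definition center :: "nat \<Rightarrow> nat \<Rightarrow> nat \<Rightarrow> nat \<Rightarrow> real" where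
  "center n m k l = (real m - l) * (real n - m - k + l) + ((real m)\<^sup>2 + (real n - m)\<^sup>2) / 2"

definition profile_fun ::
    "nat \<Rightarrow> nat \<Rightarrow> nat \<Rightarrow> nat \<Rightarrow> (nat \<Rightarrow> nat \<Rightarrow> real) \<Rightarrow> nat set \<Rightarrow> complex" where
  "profile_fun n m k l \<phi> S =
     (if S \<subseteq> {..<n} \<and> card S = m
      then of_real (\<phi> (card ({..<l} - S)) (card ({l..<k} \<inter> S))) else 0)"

lemma card_swap_diff:
  assumes "finite G" "p \<in> S" "q \<notin> S"
  shows "card (G - insert q (S - {p})) = card (G - S) + of_bool (p \<in> G) - of_bool (q \<in> G)"
proof -
  have "G - insert q (S - {p}) = (if p \<in> G then insert p (G - S) else G - S) - {q}"
    using assms by auto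
  then show ?thesis using assms by (auto simp: card_Diff_singleton_if)
qed

lemma card_swap_inter:
  assumes "finite G" "p \<in> S" "q \<notin> S"
  shows "card (G \<inter> insert q (S - {p})) = card (G \<inter> S) + of_bool (q \<in> G) - of_bool (p \<in> G)"
proof -
  have "G \<inter> insert q (S - {p}) = (if q \<in> G then insert q (G \<inter> S) else G \<inter> S) - {p}"
    using assms by auto
  then show ?thesis using assms by (auto simp: card_Diff_singleton_if)
qed

text \<open>Moving a one from one block to a zero of another changes the profile by an amount that
  depends only on the two blocks, so the exchange splits into nine block sums. The three within a
  block keep (i, j); their total minus M N is the diagonal coefficient.\<close>

lemma exchange_profile_fun:
  assumes lm: "l \<le> m" "l \<le> k" "m \<le> n" "k \<le> n" and S: "S \<subseteq> {..<n}" "card S = m"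
  defines "M \<equiv> real m - l" and "N \<equiv> real n - m - k + l"
  shows "exchange n (profile_fun n m k l \<phi>) S - of_real (M * N) * profile_fun n m k l \<phi> S =
     profile_fun n m k l (profile_op l (real k - l) M N \<phi>) S"
proof -
  define i where "i = card ({..<l} - S)"
  define j where "j = card ({l..<k} \<inter> S)"
  define S1 where "S1 = {..<l} \<inter> S"
  define S2 where "S2 = {l..<k} \<inter> S"
  define S3 where "S3 = {k..<n} \<inter> S"
  define Z1 where "Z1 = {..<l} - S"
  define Z2 where "Z2 = {l..<k} - S"
  define Z3 where "Z3 = {k..<n} - S"
  note defs = S1_def S2_def S3_def Z1_def Z2_def Z3_def
  have fin: "finite S1" "finite S2" "finite S3" "finite Z1" "finite Z2" "finite Z3"
    by (auto simp: defs)
  have SU: "S = S1 \<union> (S2 \<union> S3)" and ZU: "{..<n} - S = Z1 \<union> (Z2 \<union> Z3)"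
    using S lm by (auto simp: defs)
  have cS: "real (card S1) = l - real i" "card S2 = j" "card Z1 = i" "real (card Z2) = real k - l - j"
    using lm card_Diff_subset_Int[of "{..<l}" S] card_Diff_subset_Int[of "{l..<k}" S]
      card_mono[of "{..<l}" "{..<l} \<inter> S"] card_mono[of "{l..<k}" "{l..<k} \<inter> S"]
    by (auto simp: defs i_def j_def of_nat_diff)
  have disj: "S1 \<inter> (S2 \<union> S3) = {}" "S2 \<inter> S3 = {}" "Z1 \<inter> (Z2 \<union> Z3) = {}" "Z2 \<inter> Z3 = {}"
    using lm by (auto simp: defs)
  have "m = card S1 + (card S2 + card S3)"
    unfolding S(2)[symmetric] using arg_cong[OF SU, of card] by (simp add: card_Un_disjoint fin disj)
  then have c3: "real (card S3) = M + i - j" using cS by (simp add: M_def)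
  have "card S3 + card Z3 = n - k"
    using card_Diff_subset_Int[of "{k..<n}" S] card_mono[of "{k..<n}" "{k..<n} \<inter> S"]
    by (auto simp: defs)
  then have z3: "real (card Z3) = N - i + j" using c3 lm by (simp add: N_def M_def of_nat_diff)
  let ?f = "profile_fun n m k l \<phi>"
  have split: "sum g S = sum g S1 + sum g S2 + sum g S3"
     "sum g ({..<n} - S) = sum g Z1 + sum g Z2 + sum g Z3" for g :: "nat \<Rightarrow> complex"
    unfolding ZU using arg_cong[OF SU, of "sum g"] by (simp_all add: sum.union_disjoint fin disj add.assoc)
  have val: "?f (insert q (S - {p})) = of_real (\<phi>
      (i + of_bool (p \<in> {..<l}) - of_bool (q \<in> {..<l}))
      (j + of_bool (q \<in> {l..<k}) - of_bool (p \<in> {l..<k})))"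
    if "p \<in> S" "q \<in> {..<n} - S" for p q
  proof -
    have "card (insert q (S - {p})) = m"
      using that S finite_subset[of S "{..<n}"] card_gt_0_iff[of S] by (auto simp: card_Diff_singleton)
    then show ?thesis
      using that S by (auto simp: profile_fun_def card_swap_diff card_swap_inter i_def j_def)
  qed
  have block: "(\<Sum>p\<in>A. \<Sum>q\<in>B. ?f (insert q (S - {p}))) = of_real (real (card A) * real (card B) * v)"
    if "A \<subseteq> S" "B \<subseteq> {..<n} - S"
      "\<And>p q. p \<in> A \<Longrightarrow> q \<in> B \<Longrightarrow> \<phi> (i + of_bool (p \<in> {..<l}) - of_bool (q \<in> {..<l}))
      (j + of_bool (q \<in> {l..<k}) - of_bool (p \<in> {l..<k})) = v" for A B v
  proof -
    have "(\<Sum>p\<in>A. \<Sum>q\<in>B. ?f (insert q (S - {p}))) = (\<Sum>p\<in>A. \<Sum>q\<in>B. of_real v)"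
      using that by (intro sum.cong refl, subst val) auto
    then show ?thesis by simp
  qed
  have sub: "S1 \<subseteq> S" "S2 \<subseteq> S" "S3 \<subseteq> S"
    "Z1 \<subseteq> {..<n} - S" "Z2 \<subseteq> {..<n} - S" "Z3 \<subseteq> {..<n} - S" using SU ZU by blast+
  have "exchange n ?f S =
     of_real (real (card S1) * card Z1 * \<phi> i j) + of_real (real (card S2) * card Z1 * \<phi> (i-1) (j-1))
     + of_real (real (card S3) * card Z1 * \<phi> (i-1) j)
     + (of_real (real (card S1) * card Z2 * \<phi> (i+1) (j+1)) + of_real (real (card S2) * card Z2 * \<phi> i j)
     + of_real (real (card S3) * card Z2 * \<phi> i (j+1)))
     + (of_real (real (card S1) * card Z3 * \<phi> (i+1) j) + of_real (real (card S2) * card Z3 * \<phi> i (j-1))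
     + of_real (real (card S3) * card Z3 * \<phi> i j))"
    unfolding exchange_def split sum.distrib
    by (intro arg_cong2[of _ _ _ _ "(+)"] block sub) (use lm in \<open>auto simp: defs\<close>)
  moreover have "?f S = of_real (\<phi> i j)" "profile_fun n m k l (profile_op l (real k - l) M N \<phi>) S
     = of_real (profile_op l (real k - l) M N \<phi> i j)"
    using S by (auto simp: profile_fun_def i_def j_def)
  ultimately show ?thesis
    by (simp add: cS c3 z3 profile_op_def algebra_simps flip: of_real_add of_real_mult of_real_diff)
qed

lemma shifted_casimir_profile_fun:
  assumes lm: "l \<le> m" "l \<le> k" "m \<le> n" "k \<le> n"
  shows "shifted_casimir n (center n m k l) (emb n (profile_fun n m k l \<phi>)) =
     emb n (profile_fun n m k l (profile_op l (real k - l) (real m - l) (real n - m - k + l) \<phi>))"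
proof
  fix w
  let ?f = "profile_fun n m k l \<phi>"
  let ?g = "profile_fun n m k l (profile_op l (real k - l) (real m - l) (real n - m - k + l) \<phi>)"
  show "shifted_casimir n (center n m k l) (emb n ?f) w = emb n ?g w"
  proof (cases "length w = n")
    case w: True
    define S where "S = ones w"
    have S: "S \<subseteq> {..<n}" using ones_subset[of w] w by (simp add: S_def)
    have eq: "shifted_casimir n (center n m k l) (emb n ?f) w =
       ((of_nat (card S))\<^sup>2 + (of_nat n - of_nat (card S))\<^sup>2) / 2 * ?f S + exchange n ?f S
        - of_real (center n m k l) * ?f S"
      unfolding shifted_casimir_def casimir_emb
      using w sum_transpose_exchange[OF S, of ?f] by (simp add: emb_def S_def add_divide_distrib)
    show ?thesis
    proof (cases "card S = m")
      case True
      have "shifted_casimir n (center n m k l) (emb n ?f) w =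
        exchange n ?f S - of_real ((real m - l) * (real n - m - k + l)) * ?f S"
        unfolding eq True by (simp add: center_def algebra_simps add_divide_distrib)
      then show ?thesis
        unfolding exchange_profile_fun[OF lm S True] using w by (simp add: emb_def S_def)
    next
      case False
      \<comment> \<open>Exchanges preserve the cardinality, so off weight m both sides
        vanish.\<close>
      have "card (insert q (S - {p})) = card S" if "p \<in> S" "q \<in> {..<n} - S" for p q
        using that S finite_subset[of S "{..<n}"] card_gt_0_iff[of S] by (auto simp: card_Diff_singleton)
      then have "exchange n ?f S = 0"
        unfolding exchange_def using False by (intro sum.neutral ballI) (auto simp: profile_fun_def)
      then show ?thesis using False w unfolding eq by (simp add: profile_fun_def emb_def S_def)
    qed
  qed (unfold shifted_casimir_def casimir_emb, simp add: emb_def)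
qed

lemma casimir_sum: "casimir n (\<lambda>w. \<Sum>i\<in>I. g i w) = (\<lambda>w. \<Sum>i\<in>I. casimir n (g i) w)"
  by (induction I rule: infinite_finite_induct) (simp_all add: casimir_zero casimir_add)

lemma shifted_casimir_sum:
  "shifted_casimir n \<kappa> (\<lambda>w. \<Sum>i\<in>I. g i w) = (\<lambda>w. \<Sum>i\<in>I. shifted_casimir n \<kappa> (g i) w)"
  by (simp add: shifted_casimir_def casimir_sum sum_subtractf sum_divide_distrib sum_distrib_left)

lemma shifted_casimir_scale:
  "shifted_casimir n \<kappa> (\<lambda>w. c * f w) = (\<lambda>w. c * shifted_casimir n \<kappa> f w)"
  by (rule ext) (simp add: shifted_casimir_def casimir_scale algebra_simps)

section \<open>Matrix elements at Xi\<close>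

lemma ones_bij: "bij_betw ones {w. length w = n} (Pow {..<n})"
proof (rule bij_betwI[where g = "\<lambda>S. map (\<lambda>i. i \<in> S) [0..<n]"])
  show "map (\<lambda>i. i \<in> ones w) [0..<n] = w" if "w \<in> {w. length w = n}" for w
    using that by (intro nth_equalityI) (auto simp: ones_def)
qed (use ones_subset in \<open>auto simp: ones_char_list\<close>)

lemma cinner_emb: "cinner n (emb n f) (emb n g) = (\<Sum>S\<in>Pow {..<n}. cnj (f S) * g S)"
proof -
  have "cinner n (emb n f) (emb n g) = (\<Sum>w | length w = n. cnj (f (ones w)) * g (ones w))"
    unfolding cinner_def by (intro sum.cong) (auto simp: emb_def)
  also have "\<dots> = (\<Sum>S\<in>Pow {..<n}. cnj (f S) * g S)"
    by (rule sum.reindex_bij_betw[OF ones_bij])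
  finally show ?thesis .
qed

lemma card_extreme_profile:
  assumes "l \<le> m" "l \<le> k" "k \<le> n"
  shows "card {S. S \<subseteq> {..<n} \<and> card S = m \<and> {..<l} - S = {} \<and> {l..<k} \<inter> S = {}} = (n - k) choose (m - l)"
proof -
  let ?A = "{T. T \<subseteq> {k..<n} \<and> card T = m - l}"
  have "{S. S \<subseteq> {..<n} \<and> card S = m \<and> {..<l} - S = {} \<and> {l..<k} \<inter> S = {}} = (\<union>) {..<l} ` ?A"
  proof (intro equalityI subsetI)
    fix S assume S: "S \<in> {S. S \<subseteq> {..<n} \<and> card S = m \<and> {..<l} - S = {} \<and> {l..<k} \<inter> S = {}}"
    then have "finite S" using finite_subset by auto
    then have "card (S - {..<l}) = m - l" using S card_Diff_subset[of "{..<l}" S] by auto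
    moreover have "S - {..<l} \<subseteq> {k..<n}" using S by (force simp: disjoint_iff not_less)
    moreover have "S = {..<l} \<union> (S - {..<l})" using S by auto
    ultimately show "S \<in> (\<union>) {..<l} ` ?A" by blast
  next
    fix S assume "S \<in> (\<union>) {..<l} ` ?A"
    then obtain T where T: "T \<subseteq> {k..<n}" "card T = m - l" "S = {..<l} \<union> T" by auto
    moreover have "finite T" using T finite_subset by auto
    moreover have "{..<l} \<inter> T = {}" using T assms by fastforce
    ultimately show "S \<in> {S. S \<subseteq> {..<n} \<and> card S = m \<and> {..<l} - S = {} \<and> {l..<k} \<inter> S = {}}"
      using assms by (auto simp: card_Un_disjoint)
  qed
  moreover have "inj_on ((\<union>) {..<l}) ?A"
  proof (rule inj_onI)
    fix T T' assume "T \<in> ?A" "T' \<in> ?A" "{..<l} \<union> T = {..<l} \<union> T'"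
    then show "T = T'" using assms by (auto simp: set_eq_iff subset_iff) (meson le_trans not_le)+
  qed
  ultimately show ?thesis by (simp add: card_image n_subsets)
qed

lemma Xi_eq:
  assumes lm: "l \<le> m" "l \<le> k" "m \<le> n" "k \<le> n"
  shows "Xi n m k l = (\<lambda>w. of_real (1 / sqrt (real ((n - k) choose (m - l)))) *
     emb n (profile_fun n m k l delta00) w)"
proof
  fix w
  show "Xi n m k l w = of_real (1 / sqrt (real ((n - k) choose (m - l)))) *
     emb n (profile_fun n m k l delta00) w"
  proof (cases "length w = n")
    case w: True
    have t: "take l w = replicate l True \<longleftrightarrow> {..<l} - ones w = {}"
      using w lm by (auto simp: list_eq_iff_nth_eq ones_def)
    have "take (k - l) (drop l w) = replicate (k - l) False \<longleftrightarrow> (\<forall>i<k - l. \<not> w ! (l + i))"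
      using w lm by (auto simp: list_eq_iff_nth_eq)
    also have "\<dots> \<longleftrightarrow> {l..<k} \<inter> ones w = {}"
    proof
      assume *: "\<forall>i<k - l. \<not> w ! (l + i)"
      have "\<not> w ! i" if "l \<le> i" "i < k" for i using *[rule_format, of "i - l"] that by auto
      then show "{l..<k} \<inter> ones w = {}" by (auto simp: ones_def)
    qed (use w lm in \<open>auto simp: ones_def disjoint_iff\<close>)
    finally have f: "take (k - l) (drop l w) = replicate (k - l) False \<longleftrightarrow> {l..<k} \<inter> ones w = {}" .
    have len: "length (filter id (drop k w)) = card ({k..<n} \<inter> ones w)"
    proof -
      have "length (filter id (drop k w)) = card {i. i < n - k \<and> w ! (k + i)}"
        using w lm by (simp add: length_filter_conv_card cong: conj_cong)
      also have "\<dots> = card ((\<lambda>i. k + i) ` {i. i < n - k \<and> w ! (k + i)})"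
        by (simp add: card_image)
      also have "(\<lambda>i. k + i) ` {i. i < n - k \<and> w ! (k + i)} = {k..<n} \<inter> ones w"
      proof (intro equalityI subsetI)
        fix i assume "i \<in> {k..<n} \<inter> ones w"
        then show "i \<in> (\<lambda>i. k + i) ` {i. i < n - k \<and> w ! (k + i)}"
          by (intro image_eqI[of _ _ "i - k"]) (auto simp: ones_def)
      qed (use w in \<open>auto simp: ones_def\<close>)
      finally show ?thesis .
    qed
    have "card (ones w) = m \<longleftrightarrow> card ({k..<n} \<inter> ones w) = m - l"
      if "{..<l} - ones w = {}" "{l..<k} \<inter> ones w = {}"
    proof -
      have "ones w = {..<l} \<union> ({k..<n} \<inter> ones w)"
        using that ones_subset[of w] w by (force simp: disjoint_iff not_less)
      moreover have "card ({..<l} \<union> ({k..<n} \<inter> ones w)) = l + card ({k..<n} \<inter> ones w)"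
        using lm by (subst card_Un_disjoint) auto
      ultimately show ?thesis using lm by auto
    qed
    then show ?thesis
      using w ones_subset[of w] unfolding Xi_def t f len
      by (auto simp: emb_def profile_fun_def delta00_def)
  qed (simp add: Xi_def emb_def)
qed

lemma profile_fun_weight: "profile_fun n m k l \<phi> \<in> weight n m"
  by (simp add: weight_def profile_fun_def)

text \<open>The sets of profile (0, 0) are the strings occurring in Xi, and their number cancels the
  two normalising factors. A matrix element at Xi is thus a single value of a profile
  function.\<close>

lemma cinner_Xi_profile_fun:
  assumes lm: "l \<le> m" "l \<le> k" "m \<le> n" "k \<le> n" "m + k \<le> n + l"
  shows "cinner n (Xi n m k l) (\<lambda>w. of_real (1 / sqrt (real ((n - k) choose (m - l)))) *
     emb n (profile_fun n m k l \<phi>) w) = of_real (\<phi> 0 0)"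
proof -
  let ?B = "(n - k) choose (m - l)"
  let ?A = "{S. S \<subseteq> {..<n} \<and> card S = m \<and> {..<l} - S = {} \<and> {l..<k} \<inter> S = {}}"
  have B: "?B > 0" using lm by simp
  have "(\<Sum>S\<in>Pow {..<n}. cnj (profile_fun n m k l delta00 S) * profile_fun n m k l \<phi> S)
     = (\<Sum>S\<in>?A. of_real (\<phi> 0 0))"
  proof (rule sum.mono_neutral_cong_right)
    show "\<forall>S\<in>Pow {..<n} - ?A. cnj (profile_fun n m k l delta00 S) * profile_fun n m k l \<phi> S = 0"
      by (auto simp: profile_fun_def delta00_def)
    fix S assume S: "S \<in> ?A"
    then have z: "card ({..<l} - S) = 0" "card ({l..<k} \<inter> S) = 0" by auto
    show "cnj (profile_fun n m k l delta00 S) * profile_fun n m k l \<phi> S = of_real (\<phi> 0 0)"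
      using S unfolding profile_fun_def delta00_def z by simp
  qed auto
  also have "\<dots> = of_nat ?B * of_real (\<phi> 0 0)" using card_extreme_profile[of l m k n] lm by simp
  finally have e: "cinner n (emb n (profile_fun n m k l delta00)) (emb n (profile_fun n m k l \<phi>))
     = of_nat ?B * of_real (\<phi> 0 0)" unfolding cinner_emb .
  have "(of_real (1 / sqrt ?B))\<^sup>2 * of_nat ?B = (1::complex)"
    using B by (simp add: field_simps flip: of_real_power)
  then show ?thesis
    unfolding Xi_eq[OF lm(1-4)] cinner_scale_left cinner_scale_right e
    by (simp add: power2_eq_square mult_ac)
qed

text \<open>The power t of the shifted operator at Xi is evaluated twice: on profiles, where pairing
  with Xi reads off the value at (0, 0), and on components, where it is a scalar. The probabilities
  are squared norms of components; t = 0 gives total mass 1.\<close>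

lemma p_pmf_moments:
  assumes lm: "l \<le> m" "l \<le> k" "m \<le> n" "k \<le> n" "m + k \<le> n + l"
  shows "(\<Sum>x\<le>n div 2. p_pmf n m k l x * (casimir_eig n x / 2 - center n m k l) ^ t) =
     (profile_op l (real k - l) (real m - l) (real n - m - k + l) ^^ t) delta00 0 0"
    and "x \<le> n div 2 \<Longrightarrow> 0 \<le> p_pmf n m k l x"
proof -
  let ?c = "complex_of_real (1 / sqrt (real ((n - k) choose (m - l))))"
  let ?P = "profile_op l (real k - l) (real m - l) (real n - m - k + l)"
  let ?C = "shifted_casimir n (center n m k l)"
  let ?X = "Xi n m k l"
  let ?q = "\<lambda>x. casimir_eig n x / 2 - center n m k l"
  have "?X = emb n (\<lambda>S. ?c * profile_fun n m k l delta00 S)"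
    unfolding Xi_eq[OF lm(1-4)] by (simp add: emb_def fun_eq_iff)
  then obtain u where u: "\<And>x. u x \<in> isotypic n x" and Xu: "?X = (\<lambda>w. \<Sum>x\<le>n div 2. u x w)"
    using isotypic_decomp[OF csubspace_scale[OF csubspace_weight profile_fun_weight] lm(3)] by metis
  have proj: "oproj n (isotypic n x) ?X = u x" if "x \<le> n div 2" for x
    by (rule oproj_isotypic[OF u Xu that])
  have 1: "(?C ^^ t) ?X = (\<lambda>w. ?c * emb n (profile_fun n m k l ((?P ^^ t) delta00)) w)" for t
  proof (induction t)
    case (Suc t)
    then show ?case
      by (simp only: funpow.simps comp_apply shifted_casimir_scale shifted_casimir_profile_fun[OF lm(1-4)])
  qed (simp add: Xi_eq[OF lm(1-4)])
  have eig: "?C (u x) = (\<lambda>w. of_real (?q x) * u x w)" for x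
    by (rule ext) (simp add: shifted_casimir_def isotypic_casimir[OF u] algebra_simps)
  have 2: "(?C ^^ t) ?X = (\<lambda>w. \<Sum>x\<le>n div 2. of_real (?q x ^ t) * u x w)" for t
  proof (induction t)
    case (Suc t)
    have "(?C ^^ Suc t) ?X = ?C (\<lambda>w. \<Sum>x\<le>n div 2. of_real (?q x ^ t) * u x w)"
      by (simp only: funpow.simps comp_apply Suc)
    also have "\<dots> = (\<lambda>w. \<Sum>x\<le>n div 2. of_real (?q x ^ Suc t) * u x w)"
      unfolding shifted_casimir_sum shifted_casimir_scale eig
      by (simp add: mult_ac)
    finally show ?case .
  qed (simp add: Xu)
  have "(\<Sum>x\<le>n div 2. p_pmf n m k l x * ?q x ^ t) = Re (cinner n ?X ((?C ^^ t) ?X))"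
    unfolding 2 cinner_sum_right cinner_scale_right Re_sum
    by (intro sum.cong refl) (simp add: p_pmf_def proj flip: of_real_power)
  also have "\<dots> = (?P ^^ t) delta00 0 0"
    unfolding 1 cinner_Xi_profile_fun[OF lm] by simp
  finally show "(\<Sum>x\<le>n div 2. p_pmf n m k l x * ?q x ^ t) = (?P ^^ t) delta00 0 0" .
  assume x: "x \<le> n div 2"
  have "cinner n ?X (u x) = (\<Sum>y\<le>n div 2. cinner n (u y) (u x))"
    by (subst Xu) (rule cinner_sum_left)
  also have "\<dots> = cinner n (u x) (u x)"
    using x isotypic_orthogonal[OF u u] by (subst sum.remove[of _ x]) (auto intro!: sum.neutral)
  finally have "p_pmf n m k l x = Re (cinner n (u x) (u x))" by (simp add: p_pmf_def proj x)
  then show "0 \<le> p_pmf n m k l x" by (simp add: cinner_def sum_nonneg)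
qed

subsection \<open>Moment bounds\<close>

text \<open>No step stays at (0, 0), and the three summands are the round trips through (1, 0), (0,
  1) and (1, 1).\<close>

lemma profile_op_moments_1_2:
  "(profile_op a b M N ^^ 1) delta00 0 0 = 0"
  "(profile_op a b M N ^^ 2) delta00 0 0 = a * N * (M + 1) + M * b * (N + 1) + a * b"
  by (simp_all add: profile_op_def delta00_def numeral_2_eq_2 algebra_simps)

text \<open>Here p is the weight exponent of the current profile, q that of the neighbour, d the
  order of the coefficient. The condition p + d <= q + 3 is tight for single shifts (d = 4 upward, d
  = 2 downward) and has slack 1 for the diagonal (d = 2) and the double shifts (d = 4 and d =
  0).\<close>

lemma weighted_term_bound:
  fixes s :: real
  assumes "\<bar>c\<bar> \<le> C * s ^ d" "\<bar>\<phi>\<bar> * s ^ q \<le> B" "p + d \<le> q + 3" "1 \<le> s" "0 \<le> C"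
  shows "\<bar>c * \<phi>\<bar> * s ^ p \<le> C * B * s ^ 3"
proof -
  have "\<bar>c * \<phi>\<bar> * s ^ p = \<bar>c\<bar> * (\<bar>\<phi>\<bar> * s ^ p)" by (simp add: abs_mult)
  also have "\<dots> \<le> C * s ^ d * (\<bar>\<phi>\<bar> * s ^ p)"
    using assms by (intro mult_right_mono) auto
  also have "\<dots> = C * (\<bar>\<phi>\<bar> * s ^ (p + d))" by (simp add: power_add)
  also have "\<dots> \<le> C * (\<bar>\<phi>\<bar> * s ^ (q + 3))"
    using assms by (intro mult_left_mono power_increasing) auto
  also have "\<dots> = C * s ^ 3 * (\<bar>\<phi>\<bar> * s ^ q)" by (simp add: power_add)
  also have "\<dots> \<le> C * s ^ 3 * B"
    using assms by (intro mult_left_mono) auto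
  finally show ?thesis by (simp add: mult_ac)
qed

lemma weighted_abs_add:
  fixes x y s :: real
  assumes "\<bar>x\<bar> * s \<le> A" "\<bar>y\<bar> * s \<le> B" "0 \<le> s"
  shows "\<bar>x + y\<bar> * s \<le> A + B"
  using assms mult_right_mono[OF abs_triangle_ineq[of x y] assms(3)] by (simp add: distrib_right)

text \<open>With s^2 = n, raising i or j costs a factor n^2 and lowering it only n, which the weight s^(i + j)
  balances to n^(3/2) per step.\<close>

lemma profile_op_pow_bound:
  "\<exists>K\<ge>0. \<forall>a b M N s. 0 \<le> a \<and> a \<le> s\<^sup>2 \<and> 0 \<le> b \<and> b \<le> s\<^sup>2 \<and> 0 \<le> M \<and> M \<le> s\<^sup>2 \<and>
      0 \<le> N \<and> N \<le> s\<^sup>2 \<and> (1::real) \<le> s \<longrightarrow>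
      (\<forall>i\<le>R. \<forall>j\<le>R. \<bar>(profile_op a b M N ^^ t) delta00 i j\<bar> * s ^ (i + j) \<le> K * s ^ (3 * t))"
proof (induction t arbitrary: R)
  case 0
  show ?case by (rule exI[of _ 1]) (auto simp: delta00_def)
next
  case (Suc t)
  \<comment> \<open>One step reads the neighbours i + 1 and j + 1, so the range of profiles must
    grow by one.\<close>
  from Suc.IH[of "Suc R"] obtain K where K0: "K \<ge> 0" and
    K: "\<forall>a b M N s. 0 \<le> a \<and> a \<le> s\<^sup>2 \<and> 0 \<le> b \<and> b \<le> s\<^sup>2 \<and> 0 \<le> M \<and> M \<le> s\<^sup>2 \<and>
      0 \<le> N \<and> N \<le> s\<^sup>2 \<and> (1::real) \<le> s \<longrightarrow>
      (\<forall>i\<le>Suc R. \<forall>j\<le>Suc R. \<bar>(profile_op a b M N ^^ t) delta00 i j\<bar> * s ^ (i + j) \<le> K * s ^ (3 * t))"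
    by (elim exE conjE)
  define c :: real where "c = real R + 1"
  show ?case
  \<comment> \<open>11 is 5 for the diagonal coefficient plus 1 for each of the six shifts; c bounds
    i and j, and c s^2 bounds the block counts.\<close>
  proof (intro exI[of _ "11 * c\<^sup>2 * K"] conjI allI impI)
    show "0 \<le> 11 * c\<^sup>2 * K" using K0 by simp
    fix a b M N s :: real and i j :: nat
    assume as: "0 \<le> a \<and> a \<le> s\<^sup>2 \<and> 0 \<le> b \<and> b \<le> s\<^sup>2 \<and> 0 \<le> M \<and> M \<le> s\<^sup>2 \<and>
      0 \<le> N \<and> N \<le> s\<^sup>2 \<and> 1 \<le> s" and ij: "i \<le> R" "j \<le> R"
    define \<phi> where "\<phi> = (profile_op a b M N ^^ t) delta00"
    have s1: "1 \<le> s" "1 \<le> s\<^sup>2" using as one_le_power by auto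
    have c1: "1 \<le> c" "real i \<le> c" "real j \<le> c" using ij by (auto simp: c_def)
    have \<phi>: "\<bar>\<phi> i' j'\<bar> * s ^ (i' + j') \<le> K * s ^ (3 * t)" if "i' \<le> Suc R" "j' \<le> Suc R" for i' j'
      unfolding \<phi>_def using K[rule_format, OF as that] .
    have Rs: "real R \<le> real R * s\<^sup>2" using mult_left_mono[OF s1(2), of "real R"] by simp
    have base: "\<bar>a - i\<bar> \<le> c * s\<^sup>2" "\<bar>b - j\<bar> \<le> c * s\<^sup>2" "\<bar>M + i - j\<bar> \<le> c * s\<^sup>2" "\<bar>N - i + j\<bar> \<le> c * s\<^sup>2"
      using as ij Rs unfolding c_def distrib_right by linarith+
    have prod4: "\<bar>x * y\<bar> \<le> c\<^sup>2 * s ^ 4" if "\<bar>x\<bar> \<le> c * s\<^sup>2" "\<bar>y\<bar> \<le> c * s\<^sup>2" for x y :: real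
    proof -
      have "\<bar>x\<bar> * \<bar>y\<bar> \<le> (c * s\<^sup>2) * (c * s\<^sup>2)" using that c1 s1 by (intro mult_mono) auto
      then show ?thesis by (simp add: abs_mult power2_eq_square power4_eq_xxxx mult_ac)
    qed
    have prod2: "\<bar>x * y\<bar> \<le> c\<^sup>2 * s ^ 2" if "\<bar>x\<bar> \<le> c * s\<^sup>2" "\<bar>y\<bar> \<le> c" for x y :: real
    proof -
      have "\<bar>x\<bar> * \<bar>y\<bar> \<le> (c * s\<^sup>2) * c" using that c1 s1 by (intro mult_mono) auto
      then show ?thesis by (simp add: abs_mult power2_eq_square mult_ac)
    qed
    have d1: "\<bar>(a - i) * i\<bar> \<le> c\<^sup>2 * s ^ 2" "\<bar>(b - j) * j\<bar> \<le> c\<^sup>2 * s ^ 2"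
      using base c1 by (auto intro!: prod2)
    have sc: "s\<^sup>2 \<le> c * s\<^sup>2" using mult_right_mono[OF c1(1), of "s\<^sup>2"] by simp
    have d2: "\<bar>M * (real j - real i)\<bar> \<le> c\<^sup>2 * s ^ 2" "\<bar>N * (real i - real j)\<bar> \<le> c\<^sup>2 * s ^ 2"
      using as c1 ij order_trans[OF _ sc, of M] order_trans[OF _ sc, of N] by (auto intro!: prod2)
    have "\<bar>real i - real j\<bar> \<le> c" using c1 by auto
    then have "\<bar>(real i - real j) * (real i - real j)\<bar> \<le> c\<^sup>2 * s ^ 2"
    proof (rule prod2[rotated])
      have "c \<le> c * s\<^sup>2" using mult_left_mono[OF s1(2), of c] c1 by simp
      then show "\<bar>real i - real j\<bar> \<le> c * s\<^sup>2" using c1 by linarith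
    qed
    \<comment> \<open>Subtracting M N leaves five terms of order s^2, whereas the product alone may
      have order s^4. This cancellation is what the centring buys.\<close>
    then have diag: "\<bar>(a - i) * i + j * (b - j) + (M + i - j) * (N - i + j) - M * N\<bar> \<le> 5 * c\<^sup>2 * s ^ 2"
      using d1 d2 by (simp add: abs_le_iff algebra_simps)
    define e where "e = c\<^sup>2 * (K * s ^ (3 * t)) * s ^ 3"
    have t0: "\<bar>((a - i) * i + j * (b - j) + (M + i - j) * (N - i + j) - M * N) * \<phi> i j\<bar> * s ^ (i + j)
        \<le> 5 * e"
      using weighted_term_bound[OF diag \<phi>[of i j], of "i + j"] ij s1
      by (simp add: e_def mult.assoc)
    have t1: "\<bar>(a - i) * (N - i + j) * \<phi> (i + 1) j\<bar> * s ^ (i + j) \<le> e"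
      unfolding e_def
      by (rule weighted_term_bound[OF prod4 \<phi>]) (use ij s1 base in auto)
    have t2: "\<bar>(M + i - j) * i * \<phi> (i - 1) j\<bar> * s ^ (i + j) \<le> e"
      unfolding e_def
      by (rule weighted_term_bound[OF prod2 \<phi>]) (use ij s1 base c1 in auto)
    have t3: "\<bar>(M + i - j) * (b - j) * \<phi> i (j + 1)\<bar> * s ^ (i + j) \<le> e"
      unfolding e_def
      by (rule weighted_term_bound[OF prod4 \<phi>]) (use ij s1 base in auto)
    have t4: "\<bar>j * (N - i + j) * \<phi> i (j - 1)\<bar> * s ^ (i + j) \<le> e"
      unfolding e_def
      by (rule weighted_term_bound[OF prod2[of "N - i + j" "real j", unfolded mult.commute[of _ "real j"]] \<phi>])
        (use ij s1 base c1 in auto)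
    have t5: "\<bar>(a - i) * (b - j) * \<phi> (i + 1) (j + 1)\<bar> * s ^ (i + j) \<le> e"
      unfolding e_def
      by (rule weighted_term_bound[OF prod4 \<phi>]) (use ij s1 base in auto)
    have "\<bar>real j * i\<bar> \<le> c\<^sup>2 * s ^ 0"
      using c1 mult_mono[of "real j" c "real i" c] by (simp add: power2_eq_square)
    then have t6: "\<bar>real j * i * \<phi> (i - 1) (j - 1)\<bar> * s ^ (i + j) \<le> e"
      unfolding e_def
      by (rule weighted_term_bound[OF _ \<phi>]) (use ij s1 base c1 in auto)
    have s0: "0 \<le> s ^ (i + j)" using s1 by simp
    let ?t0 = "((a - i) * i + j * (b - j) + (M + i - j) * (N - i + j) - M * N) * \<phi> i j"
    let ?t1 = "(a - i) * (N - i + j) * \<phi> (i + 1) j" and ?t2 = "(M + i - j) * i * \<phi> (i - 1) j"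
    let ?t3 = "(M + i - j) * (b - j) * \<phi> i (j + 1)" and ?t4 = "j * (N - i + j) * \<phi> i (j - 1)"
    let ?t5 = "(a - i) * (b - j) * \<phi> (i + 1) (j + 1)" and ?t6 = "real j * i * \<phi> (i - 1) (j - 1)"
    have "(profile_op a b M N ^^ Suc t) delta00 i j = ?t0 + ?t1 + ?t2 + ?t3 + ?t4 + ?t5 + ?t6"
      by (simp only: funpow.simps comp_apply \<phi>_def[symmetric] profile_op_def[of a b M N \<phi>])
    also have "\<bar>\<dots>\<bar> * s ^ (i + j) \<le> 5 * e + e + e + e + e + e + e"
      by (rule weighted_abs_add[OF weighted_abs_add[OF weighted_abs_add[OF
        weighted_abs_add[OF weighted_abs_add[OF weighted_abs_add[OF t0 t1 s0] t2 s0] t3 s0] t4 s0] t5 s0] t6 s0])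
    also have "\<dots> = 11 * e" by simp
    also have "\<dots> = 11 * c\<^sup>2 * K * (s ^ (3 * t) * s ^ 3)" by (simp only: e_def mult.assoc)
    also have "s ^ (3 * t) * s ^ 3 = s ^ (3 * Suc t)" unfolding power_add[symmetric] by (simp add: add.commute)
    finally show "\<bar>(profile_op a b M N ^^ Suc t) delta00 i j\<bar> * s ^ (i + j)
        \<le> 11 * c\<^sup>2 * K * s ^ (3 * Suc t)" .
  qed
qed

lemma fourth_moment_bound:
  obtains K where "K \<ge> 0" "\<And>a b M N n. 0 \<le> a \<Longrightarrow> a \<le> n \<Longrightarrow> 0 \<le> b \<Longrightarrow> b \<le> n \<Longrightarrow> 0 \<le> M \<Longrightarrow> M \<le> n \<Longrightarrow>
    0 \<le> N \<Longrightarrow> N \<le> n \<Longrightarrow> 1 \<le> n \<Longrightarrow> (profile_op a b M N ^^ 4) delta00 0 0 \<le> K * n ^ 6"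
proof -
  from profile_op_pow_bound[of 0 4] obtain K where K0: "K \<ge> 0" and
    K: "\<forall>a b M N s. 0 \<le> a \<and> a \<le> s\<^sup>2 \<and> 0 \<le> b \<and> b \<le> s\<^sup>2 \<and> 0 \<le> M \<and> M \<le> s\<^sup>2 \<and>
      0 \<le> N \<and> N \<le> s\<^sup>2 \<and> (1::real) \<le> s \<longrightarrow>
      (\<forall>i\<le>0. \<forall>j\<le>0. \<bar>(profile_op a b M N ^^ 4) delta00 i j\<bar> * s ^ (i + j) \<le> K * s ^ (3 * 4))"
    by (elim exE conjE)
  show ?thesis
  proof (rule that[OF K0])
    fix a b M N n :: real
    assume as: "0 \<le> a" "a \<le> n" "0 \<le> b" "b \<le> n" "0 \<le> M" "M \<le> n" "0 \<le> N" "N \<le> n" "1 \<le> n"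
    have "sqrt n ^ 12 = n ^ 6"
      using as power_mult[of "sqrt n" 2 6] by simp
    then show "(profile_op a b M N ^^ 4) delta00 0 0 \<le> K * n ^ 6"
      using K[rule_format, of a "sqrt n" b M N 0 0] as by simp
  qed
qed

text \<open>The error is governed by the third absolute moment, which |z|^3 <= (z^4 / h + h z^2) / 2 reduces to
  the even ones.\<close>

lemma sqrt_moment_expansion:
  fixes p y :: "nat \<Rightarrow> real" and q v :: real
  assumes p: "\<And>x. x \<in> I \<Longrightarrow> p x \<ge> 0" "sum p I = 1" and y: "\<And>x. x \<in> I \<Longrightarrow> y x \<ge> 0" and q: "q > 0"
    and m1: "(\<Sum>x\<in>I. p x * ((y x)\<^sup>2 - q)) = 0" and m2: "(\<Sum>x\<in>I. p x * ((y x)\<^sup>2 - q)\<^sup>2) = v"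
    and m4: "(\<Sum>x\<in>I. p x * ((y x)\<^sup>2 - q) ^ 4) \<le> w" and h: "h > 0"
  defines "V \<equiv> (\<Sum>x\<in>I. p x * (y x - sqrt q)\<^sup>2)"
  shows "(\<Sum>x\<in>I. p x * y x) = sqrt q - V / (2 * sqrt q)"
    and "\<bar>V - v / (4 * q)\<bar> \<le> 3 / (8 * q\<^sup>2) * (w / h + h * v)"
proof -
  define r where "r = sqrt q"
  have r: "r > 0" "r\<^sup>2 = q" using q by (auto simp: r_def)
  have "p x * y x = p x * r + p x * ((y x)\<^sup>2 - q) / (2 * r) - p x * (y x - r)\<^sup>2 / (2 * r)" for x
  proof -
    \<comment> \<open>An exact expansion of the root: the middle term has mean zero by
      \<open>m1\<close>, the last one produces V.\<close>
    have "y x = r + ((y x)\<^sup>2 - q) / (2 * r) - (y x - r)\<^sup>2 / (2 * r)"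
      using r(1) unfolding r(2)[symmetric] by (simp add: field_simps power2_eq_square)
    then have "p x * y x = p x * (r + ((y x)\<^sup>2 - q) / (2 * r) - (y x - r)\<^sup>2 / (2 * r))" by simp
    then show ?thesis by (simp add: algebra_simps)
  qed
  then have "(\<Sum>x\<in>I. p x * y x) = sum p I * r + (\<Sum>x\<in>I. p x * ((y x)\<^sup>2 - q)) / (2 * r) - V / (2 * r)"
    unfolding V_def r_def[symmetric]
    by (simp add: sum.distrib sum_subtractf sum_distrib_right sum_divide_distrib)
  then show "(\<Sum>x\<in>I. p x * y x) = sqrt q - V / (2 * sqrt q)" using p m1 by (simp add: r_def)
  have pt: "\<bar>(y - r)\<^sup>2 - (y\<^sup>2 - q)\<^sup>2 / (4 * q)\<bar> \<le> 3 / (8 * q\<^sup>2) * ((y\<^sup>2 - q) ^ 4 / h + h * (y\<^sup>2 - q)\<^sup>2)"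
    if y: "y \<ge> 0" for y :: real
  proof -
    define z where "z = y\<^sup>2 - q"
    have zf: "z = (y - r) * (y + r)" unfolding z_def r(2)[symmetric] by (simp add: power2_eq_square algebra_simps)
    \<comment> \<open>From z = (y - r)(y + r) and 4 q - (y + r)^2 = (r - y)(y + 3 r).\<close>
    have "(y - r)\<^sup>2 - z\<^sup>2 / (4 * q) = - ((y - r) ^ 3 * (y + 3 * r)) / (4 * q)"
      unfolding zf using r by (simp add: field_simps power2_eq_square power3_eq_cube flip: r(2))
    then have "\<bar>(y - r)\<^sup>2 - z\<^sup>2 / (4 * q)\<bar> = \<bar>y - r\<bar> ^ 3 * (y + 3 * r) / (4 * q)"
      using y r q by (simp add: abs_mult power_abs)
    \<comment> \<open>Brings in the factor (y + r)^3 missing from |z|^3, since y + 3 r <= 3 (y + r)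
      and q = r^2 <= (y + r)^2.\<close>
    also have "\<dots> \<le> \<bar>y - r\<bar> ^ 3 * (3 * ((y + r) ^ 3 / q)) / (4 * q)"
    proof (intro divide_right_mono mult_left_mono)
      have "r\<^sup>2 \<le> (y + r)\<^sup>2" using y r(1) by (intro power_mono) auto
      then have "(y + r) * q \<le> (y + r) ^ 3"
        using y r by (simp add: power3_eq_cube power2_eq_square mult_left_mono mult.assoc)
      then have "y + r \<le> (y + r) ^ 3 / q" using q by (simp add: field_simps)
      then show "y + 3 * r \<le> 3 * ((y + r) ^ 3 / q)" using y by linarith
    qed (use q in auto)
    also have "\<dots> = 3 / (4 * q\<^sup>2) * \<bar>z\<bar> ^ 3"
      unfolding zf using y r by (simp add: abs_mult power_mult_distrib power2_eq_square)
    also have "\<dots> \<le> 3 / (4 * q\<^sup>2) * ((z ^ 4 / h + h * z\<^sup>2) / 2)"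
    proof (intro mult_left_mono)
      have "0 \<le> z\<^sup>2 * (\<bar>z\<bar> - h)\<^sup>2 / h" using h by simp
      also have "z\<^sup>2 * (\<bar>z\<bar> - h)\<^sup>2 / h = \<bar>z\<bar> ^ 2 * (\<bar>z\<bar> - h)\<^sup>2 / h" by simp
      also have "\<dots> = \<bar>z\<bar> ^ 4 / h + h * \<bar>z\<bar>\<^sup>2 - 2 * \<bar>z\<bar> ^ 3"
        using h by (simp add: field_simps power2_eq_square power3_eq_cube power4_eq_xxxx del: abs_mult_self_eq)
      also have "\<bar>z\<bar> ^ 4 = z ^ 4" by (simp add: power_even_abs)
      finally show "\<bar>z\<bar> ^ 3 \<le> (z ^ 4 / h + h * z\<^sup>2) / 2" by simp
    qed auto
    finally show ?thesis by (simp add: z_def)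
  qed
  have "V - v / (4 * q) = (\<Sum>x\<in>I. p x * ((y x - r)\<^sup>2 - ((y x)\<^sup>2 - q)\<^sup>2 / (4 * q)))"
    unfolding V_def m2[symmetric] r_def[symmetric]
    by (simp add: right_diff_distrib sum_subtractf sum_divide_distrib)
  then have "\<bar>V - v / (4 * q)\<bar> \<le> (\<Sum>x\<in>I. \<bar>p x * ((y x - r)\<^sup>2 - ((y x)\<^sup>2 - q)\<^sup>2 / (4 * q))\<bar>)"
    by simp
  also have "\<dots> \<le> (\<Sum>x\<in>I. p x * (3 / (8 * q\<^sup>2) * (((y x)\<^sup>2 - q) ^ 4 / h + h * ((y x)\<^sup>2 - q)\<^sup>2)))"
  proof (rule sum_mono)
    fix x assume x: "x \<in> I"
    show "\<bar>p x * ((y x - r)\<^sup>2 - ((y x)\<^sup>2 - q)\<^sup>2 / (4 * q))\<bar>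
        \<le> p x * (3 / (8 * q\<^sup>2) * (((y x)\<^sup>2 - q) ^ 4 / h + h * ((y x)\<^sup>2 - q)\<^sup>2))"
      unfolding abs_mult abs_of_nonneg[OF p(1)[OF x]]
      by (rule mult_left_mono[OF pt[OF y[OF x]] p(1)[OF x]])
  qed
  also have "\<dots> = 3 / (8 * q\<^sup>2) * ((\<Sum>x\<in>I. p x * ((y x)\<^sup>2 - q) ^ 4) / h + h * v)"
    unfolding m2[symmetric] sum_distrib_left sum_divide_distrib sum.distrib[symmetric]
    by (intro sum.cong refl) (simp add: algebra_simps)
  also have "\<dots> \<le> 3 / (8 * q\<^sup>2) * (w / h + h * v)"
    using m4 h q by (intro mult_left_mono add_right_mono divide_right_mono) auto
  finally show "\<bar>V - v / (4 * q)\<bar> \<le> 3 / (8 * q\<^sup>2) * (w / h + h * v)" .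
qed

subsection \<open>Asymptotics\<close>

lemma
  fixes \<alpha> \<beta> \<gamma> \<delta> :: real
  assumes nn: "\<alpha> \<ge> 0" "\<beta> \<ge> 0" "\<gamma> \<ge> 0" "\<delta> \<ge> 0" and one: "\<alpha> + \<beta> + \<gamma> + \<delta> = 1"
    and n: "n \<ge> 1" and int: "\<alpha> * real n \<in> \<int>" "(\<alpha> + \<beta>) * real n \<in> \<int>" "(\<alpha> + \<gamma>) * real n \<in> \<int>"
  defines "q \<equiv> (real n)\<^sup>2 * Dpar \<alpha> \<beta> \<gamma> \<delta> / 4 + real n / 2 + 1 / 4"
    and "y \<equiv> \<lambda>x::nat. (real n + 1) / 2 - real x"
  shows Pseq_nonneg: "x \<in> {0..n div 2} \<Longrightarrow> 0 \<le> Pseq \<alpha> \<beta> \<gamma> n x"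
    and Pseq_moments: "(\<Sum>x\<in>{0..n div 2}. Pseq \<alpha> \<beta> \<gamma> n x * ((y x)\<^sup>2 - q) ^ t) =
      (profile_op (\<alpha> * n) (\<gamma> * n) (\<beta> * n) (\<delta> * n) ^^ t) delta00 0 0"
proof -
  define l m k where "l = nat \<lfloor>\<alpha> * real n\<rfloor>" and "m = nat \<lfloor>(\<alpha> + \<beta>) * real n\<rfloor>"
    and "k = nat \<lfloor>(\<alpha> + \<gamma>) * real n\<rfloor>"
  \<comment> \<open>Integrality makes the floors in \<open>Pseq\<close> exact.\<close>
  have r: "real l = \<alpha> * n" "real m = (\<alpha> + \<beta>) * n" "real k = (\<alpha> + \<gamma>) * n"
    using nn int by (auto simp: l_def m_def k_def elim!: Ints_cases)
  have d: "\<delta> = 1 - \<alpha> - \<beta> - \<gamma>" using one by simp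
  have arg: "real k - l = \<gamma> * n" "real m - l = \<beta> * n" "real n - m - k + l = \<delta> * n"
    unfolding r d by (simp_all add: algebra_simps)
  have "0 \<le> \<beta> * n" "0 \<le> \<gamma> * n" "0 \<le> \<delta> * n" using nn by simp_all
  then have lm: "l \<le> m" "l \<le> k" "m \<le> n" "k \<le> n" "m + k \<le> n + l" using arg by linarith+
  \<comment> \<open>Completing the square in x: q is \<open>center\<close> plus (n + 1)^2/4 -
    n^2/2.\<close>
  have eig: "casimir_eig n x / 2 - center n m k l = (y x)\<^sup>2 - q" for x
    unfolding casimir_eig_def center_def arg r y_def q_def Dpar_def d
    by (simp add: field_simps power2_eq_square)
  have P: "Pseq \<alpha> \<beta> \<gamma> n x = p_pmf n m k l x" for x by (simp add: Pseq_def l_def m_def k_def)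
  show "x \<in> {0..n div 2} \<Longrightarrow> 0 \<le> Pseq \<alpha> \<beta> \<gamma> n x"
    unfolding P using p_pmf_moments(2)[OF lm] by simp
  show "(\<Sum>x\<in>{0..n div 2}. Pseq \<alpha> \<beta> \<gamma> n x * ((y x)\<^sup>2 - q) ^ t) =
      (profile_op (\<alpha> * n) (\<gamma> * n) (\<beta> * n) (\<delta> * n) ^^ t) delta00 0 0"
    using p_pmf_moments(1)[OF lm, of t] unfolding P eig arg atLeast0AtMost unfolding r(1) .
qed

text \<open>Serves twice: about sqrt q, to turn the second moment V of Y into a variance, and about
  n mu, to pass from the variance of X to the second moment in the theorem.\<close>

lemma variance_shift:
  fixes p y :: "nat \<Rightarrow> real"
  assumes "sum p I = 1"
  shows "(\<Sum>x\<in>I. p x * (y x - (\<Sum>z\<in>I. p z * y z))\<^sup>2) =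
    (\<Sum>x\<in>I. p x * (y x - c)\<^sup>2) - ((\<Sum>x\<in>I. p x * y x) - c)\<^sup>2"
proof -
  define e where "e = (\<Sum>x\<in>I. p x * y x)"
  have "(\<Sum>x\<in>I. p x * (y x - e)\<^sup>2) = (\<Sum>x\<in>I. p x * (y x - c)\<^sup>2 + (e\<^sup>2 - c\<^sup>2) * p x - 2 * (e - c) * (p x * y x))"
    by (intro sum.cong refl) (simp add: power2_eq_square algebra_simps)
  also have "\<dots> = (\<Sum>x\<in>I. p x * (y x - c)\<^sup>2) + (e\<^sup>2 - c\<^sup>2) * sum p I - 2 * (e - c) * e"
    by (simp add: sum.distrib sum_subtractf sum_distrib_left e_def)
  finally show ?thesis using assms by (simp add: e_def[symmetric] power2_eq_square algebra_simps)
qed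

text \<open>D is a square plus 4 beta delta. Its positivity gives sqrt q order n, so that dividing
  by it gains a factor n.\<close>

lemma Dpar_pos:
  assumes "\<alpha> \<ge> 0" "\<beta> \<ge> 0" "\<gamma> \<ge> 0" "\<delta> \<ge> 0" "\<alpha> + \<beta> + \<gamma> + \<delta> = 1" "\<beta> > 0" "\<delta> > 0"
  shows "Dpar \<alpha> \<beta> \<gamma> \<delta> > (0::real)"
proof -
  have d: "\<delta> = 1 - \<alpha> - \<beta> - \<gamma>" using assms by simp
  have "Dpar \<alpha> \<beta> \<gamma> \<delta> = (\<alpha> + \<beta> - \<gamma> - \<delta>)\<^sup>2 + 4 * (\<beta> * \<delta>)"
    unfolding Dpar_def d by (simp add: power2_eq_square algebra_simps)
  also have "\<dots> > 0" using assms by (intro add_nonneg_pos) auto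
  finally show ?thesis .
qed

theorem theorem5p22:
  fixes \<alpha> \<beta> \<gamma> \<delta> :: real
  assumes "\<alpha> \<ge> 0" "\<beta> \<ge> 0" "\<gamma> \<ge> 0" "\<delta> \<ge> 0" "\<alpha> + \<beta> + \<gamma> + \<delta> = 1"
    and "\<alpha> + \<gamma> > 0" "\<beta> > 0" "\<delta> > 0"
  defines "F \<equiv> inf at_top (principal {n::nat. \<alpha> * real n \<in> \<int> \<and> (\<alpha> + \<beta>) * real n \<in> \<int> \<and> (\<alpha> + \<gamma>) * real n \<in> \<int>})"
  shows "(((\<lambda>n. \<Sum>x\<in>{0..n div 2}. Pseq \<alpha> \<beta> \<gamma> n x *
              (real x / sqrt (real n) - Eseq \<alpha> \<beta> \<gamma> n / sqrt (real n)) ^ 2)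
            \<longlongrightarrow> sigma2par \<alpha> \<beta> \<gamma> \<delta>) F) \<and>
         (((\<lambda>n. \<Sum>x\<in>{0..n div 2}. Pseq \<alpha> \<beta> \<gamma> n x *
              ((real x - real n * mupar \<alpha> \<beta> \<gamma> \<delta>) / sqrt (real n)) ^ 2)
            \<longlongrightarrow> sigma2par \<alpha> \<beta> \<gamma> \<delta>) F) \<and>
         (((\<lambda>n. Eseq \<alpha> \<beta> \<gamma> n - (real n * mupar \<alpha> \<beta> \<gamma> \<delta> + phipar \<alpha> \<beta> \<gamma> \<delta>)) \<longlongrightarrow> 0) F)"
proof -
  note as = assms(1-8)
  define D where "D = Dpar \<alpha> \<beta> \<gamma> \<delta>"
  have D: "D > 0" unfolding D_def using as by (intro Dpar_pos)
  define \<sigma>2 where "\<sigma>2 = sigma2par \<alpha> \<beta> \<gamma> \<delta>"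
  have \<sigma>2: "\<sigma>2 = (\<alpha> + \<gamma>) * \<beta> * \<delta> / D" by (simp add: \<sigma>2_def sigma2par_def D_def)
  define q :: "nat \<Rightarrow> real" where "q n = (real n)\<^sup>2 * D / 4 + real n / 2 + 1 / 4" for n
  define v :: "nat \<Rightarrow> real" where "v n = (\<alpha> * n) * (\<delta> * n) * (\<beta> * n + 1) + (\<beta> * n) * (\<gamma> * n) * (\<delta> * n + 1)
     + (\<alpha> * n) * (\<gamma> * n)" for n
  define y :: "nat \<Rightarrow> nat \<Rightarrow> real" where "y n x = (real n + 1) / 2 - real x" for n x
  define P where "P = Pseq \<alpha> \<beta> \<gamma>"
  define E where "E n = (\<Sum>x\<in>{0..n div 2}. P n x * y n x)" for n
  define V where "V n = (\<Sum>x\<in>{0..n div 2}. P n x * (y n x - sqrt (q n))\<^sup>2)" for n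
  obtain K where K0: "K \<ge> 0" and K: "\<And>a b M N n. 0 \<le> a \<Longrightarrow> a \<le> n \<Longrightarrow> 0 \<le> b \<Longrightarrow> b \<le> n \<Longrightarrow>
      0 \<le> M \<Longrightarrow> M \<le> n \<Longrightarrow> 0 \<le> N \<Longrightarrow> N \<le> n \<Longrightarrow> 1 \<le> n \<Longrightarrow>
      (profile_op a b M N ^^ 4) delta00 0 0 \<le> K * n ^ 6"
    by (rule fourth_moment_bound, rule that)
  have F: "eventually Q F" if "\<And>n. n \<ge> 1 \<Longrightarrow> \<alpha> * real n \<in> \<int> \<Longrightarrow> (\<alpha> + \<beta>) * real n \<in> \<int> \<Longrightarrow>
      (\<alpha> + \<gamma>) * real n \<in> \<int> \<Longrightarrow> Q n" for Q
    unfolding F_def eventually_inf_principal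
    using eventually_ge_at_top[of 1] by eventually_elim (use that in auto)
  \<comment> \<open>q, v and err are closed forms with limits along all n; only what is built from P
    is confined to the admissible n.\<close>
  have lift: "(f \<longlongrightarrow> c) F" if "(f \<longlongrightarrow> c) sequentially" for f :: "nat \<Rightarrow> real" and c
    using that unfolding F_def by (rule tendsto_mono[OF inf_le1])
  \<comment> \<open>The choice h = n^(3/2) is the fluctuation scale of Y^2: K n^6 / h and h v are
    then both O(n^(9/2)), and division by q^2 leaves O(sqrt n), which is o(n).\<close>
  define err where "err n = 3 / (8 * (q n)\<^sup>2) * (K * real n ^ 6 / (n * sqrt n) + (n * sqrt n) * v n)" for n
  have qpos: "q n > 0" for n using D by (simp add: q_def add_nonneg_pos)
  have main: "sum (P n) {0..n div 2} = 1 \<and> E n = sqrt (q n) - V n / (2 * sqrt (q n)) \<and>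
      \<bar>V n - v n / (4 * q n)\<bar> \<le> err n"
    if n: "n \<ge> 1" "\<alpha> * real n \<in> \<int>" "(\<alpha> + \<beta>) * real n \<in> \<int>" "(\<alpha> + \<gamma>) * real n \<in> \<int>" for n
  proof -
    note mom = Pseq_moments[OF as(1-5) n, folded D_def, folded q_def y_def P_def]
    have p: "0 \<le> P n x" if "x \<in> {0..n div 2}" for x
      unfolding P_def by (rule Pseq_nonneg[OF as(1-5) n that])
    have p1: "sum (P n) {0..n div 2} = 1" using mom[of 0] by (simp add: delta00_def)
    have y0: "0 \<le> y n x" if "x \<in> {0..n div 2}" for x
      using that by (simp add: y_def)
    have m1: "(\<Sum>x\<in>{0..n div 2}. P n x * ((y n x)\<^sup>2 - q n)) = 0"
      using mom[of 1] by (simp only: profile_op_moments_1_2 power_one_right)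
    have m2: "(\<Sum>x\<in>{0..n div 2}. P n x * ((y n x)\<^sup>2 - q n)\<^sup>2) = v n"
      using mom[of 2] by (simp only: profile_op_moments_1_2 v_def)
    have m4: "(\<Sum>x\<in>{0..n div 2}. P n x * ((y n x)\<^sup>2 - q n) ^ 4) \<le> K * real n ^ 6"
      unfolding mom using as n(1) by (intro K) (auto intro!: mult_left_le_one_le)
    have h: "real n * sqrt n > 0" using n(1) by simp
    show ?thesis
      using p1 sqrt_moment_expansion[OF p p1 y0 qpos m1 m2 m4 h]
      unfolding E_def V_def err_def by simp
  qed
  \<comment> \<open>The coefficients of the exact form v = A n^3 + B n^2; A / D is sigma^2.\<close>
  define A B where "A = (\<alpha> + \<gamma>) * \<beta> * \<delta>" and "B = \<alpha> * \<delta> + \<beta> * \<gamma> + \<alpha> * \<gamma>"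
  have seq_cong: "g \<longlonglongrightarrow> c" if "f \<longlonglongrightarrow> c" "\<And>n. n \<ge> 1 \<Longrightarrow> f n = g n" for f g :: "nat \<Rightarrow> real" and c
    using that(1) by (rule Lim_transform_eventually) (use that(2) in \<open>auto simp: eventually_at_top_linorder\<close>)
  note inv0 = lim_1_over_n[where 'a = real]
  have inv_sqrt0: "(\<lambda>n. 1 / sqrt (real n)) \<longlonglongrightarrow> 0"
    using tendsto_real_sqrt[OF inv0] by (simp add: real_sqrt_divide)
  have v_scaled: "v n / real n ^ 3 = A + B * (1 / real n)" if "n \<ge> 1" for n
    using that by (simp add: v_def A_def B_def field_simps power2_eq_square power3_eq_cube)
  have q_scaled: "q n / (real n)\<^sup>2 = D / 4 + 1 / 2 * (1 / real n) + 1 / 4 * (1 / real n)\<^sup>2" if "n \<ge> 1" for n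
    using that by (simp add: q_def field_simps power2_eq_square)
  have lim_q: "(\<lambda>n. q n / (real n)\<^sup>2) \<longlonglongrightarrow> D / 4"
  proof -
    have "(\<lambda>n. D / 4 + 1 / 2 * (1 / real n) + 1 / 4 * (1 / real n)\<^sup>2) \<longlonglongrightarrow> D / 4 + 1 / 2 * 0 + 1 / 4 * 0\<^sup>2"
      by (intro tendsto_intros inv0)
    then show ?thesis
      using seq_cong[OF _ q_scaled[symmetric]] by simp
  qed
  have lim_vn: "(\<lambda>n. v n / real n ^ 3) \<longlonglongrightarrow> A"
  proof -
    have "(\<lambda>n. A + B * (1 / real n)) \<longlonglongrightarrow> A + B * 0" by (intro tendsto_intros inv0)
    then show ?thesis
      using seq_cong[OF _ v_scaled[symmetric]] by simp
  qed
  have lim_err: "(\<lambda>n. err n / n) \<longlonglongrightarrow> 0"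
  proof -
    have "(\<lambda>n. 3 / 8 * (K + v n / real n ^ 3) / (q n / (real n)\<^sup>2)\<^sup>2 * (1 / sqrt (real n)))
        \<longlonglongrightarrow> 3 / 8 * (K + A) / (D / 4)\<^sup>2 * 0"
      using D by (intro tendsto_intros lim_vn lim_q inv_sqrt0) simp
    moreover have "3 / 8 * (K + v n / real n ^ 3) / (q n / (real n)\<^sup>2)\<^sup>2 * (1 / sqrt (real n)) = err n / n"
      if "n \<ge> 1" for n
    proof -
      define s where "s = sqrt (real n)"
      have s: "s > 0" "real n = s\<^sup>2" using that by (auto simp: s_def)
      show ?thesis unfolding err_def s_def[symmetric] unfolding s(2)
        using s(1) qpos[of n] by (simp add: field_simps power_numeral_reduce)
    qed
    ultimately show ?thesis using seq_cong by simp
  qed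
  have lim_v: "(\<lambda>n. v n / (4 * q n) / n) \<longlonglongrightarrow> \<sigma>2"
  proof -
    have "(\<lambda>n. (v n / real n ^ 3) / (4 * (q n / (real n)\<^sup>2))) \<longlonglongrightarrow> A / (4 * (D / 4))"
      using D by (intro tendsto_intros lim_vn lim_q) simp
    moreover have "(v n / real n ^ 3) / (4 * (q n / (real n)\<^sup>2)) = v n / (4 * q n) / n" if "n \<ge> 1" for n
      using that qpos[of n] by (simp add: field_simps power2_eq_square power3_eq_cube)
    ultimately have "(\<lambda>n. v n / (4 * q n) / n) \<longlonglongrightarrow> A / (4 * (D / 4))"
      by (rule seq_cong)
    then show ?thesis by (simp add: \<sigma>2 A_def)
  qed
  have lim_r: "(\<lambda>n. sqrt (q n) / n) \<longlonglongrightarrow> sqrt D / 2"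
    using tendsto_real_sqrt[OF lim_q] by (simp add: real_sqrt_divide)
  have lim_r2: "(\<lambda>n. sqrt (q n) - n * sqrt D / 2) \<longlonglongrightarrow> 1 / (2 * sqrt D)"
  proof -
    have "(\<lambda>n. (1 / 2 + 1 / 4 * (1 / real n)) / (sqrt (q n) / n + sqrt D / 2))
        \<longlonglongrightarrow> (1 / 2 + 1 / 4 * 0) / (sqrt D / 2 + sqrt D / 2)"
      using D by (intro tendsto_intros inv0 lim_r) simp
    moreover have "(1 / 2 + 1 / 4 * (1 / real n)) / (sqrt (q n) / n + sqrt D / 2) = sqrt (q n) - n * sqrt D / 2"
      if "n \<ge> 1" for n
    proof -
      have pos: "sqrt (q n) + n * sqrt D / 2 > 0" using qpos[of n] D by (intro add_pos_nonneg) auto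
      \<comment> \<open>Rationalising, because sqrt q is needed up to o(1) and not only to leading
        order.\<close>
      have "(sqrt (q n) - n * sqrt D / 2) * (sqrt (q n) + n * sqrt D / 2) = q n - (real n)\<^sup>2 * D / 4"
        using qpos[of n] D by (simp add: algebra_simps power2_eq_square)
      also have "\<dots> = n / 2 + 1 / 4" by (simp add: q_def)
      finally have "sqrt (q n) - n * sqrt D / 2 = (n / 2 + 1 / 4) / (sqrt (q n) + n * sqrt D / 2)"
        using pos by (simp add: eq_divide_eq)
      also have "\<dots> = ((n / 2 + 1 / 4) / n) / ((sqrt (q n) + n * sqrt D / 2) / n)" using that by simp
      finally show ?thesis using that by (simp add: add_divide_distrib)
    qed
    ultimately have "(\<lambda>n. sqrt (q n) - n * sqrt D / 2) \<longlonglongrightarrow> (1 / 2 + 1 / 4 * 0) / (sqrt D / 2 + sqrt D / 2)"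
      by (rule seq_cong)
    then show ?thesis by (simp add: field_simps)
  qed
  have lim_V: "((\<lambda>n. V n / n) \<longlongrightarrow> \<sigma>2) F"
  proof -
    have "((\<lambda>n. V n / n - v n / (4 * q n) / n) \<longlongrightarrow> 0) F"
    proof (rule Lim_null_comparison[OF F lift[OF lim_err]])
      fix n assume n: "n \<ge> 1" "\<alpha> * real n \<in> \<int>" "(\<alpha> + \<beta>) * real n \<in> \<int>" "(\<alpha> + \<gamma>) * real n \<in> \<int>"
      have "norm (V n / n - v n / (4 * q n) / n) = \<bar>V n - v n / (4 * q n)\<bar> / n"
        unfolding diff_divide_distrib[symmetric] real_norm_def abs_divide by simp
      also have "\<dots> \<le> err n / n" using main[OF n] by (intro divide_right_mono) auto
      finally show "norm (V n / n - v n / (4 * q n) / n) \<le> err n / n" .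
    qed
    from tendsto_add[OF this lift[OF lim_v]] show ?thesis by simp
  qed
  \<comment> \<open>On admissible n this is the gap between sqrt q and the mean of Y; it converges,
    although V and sqrt q are only known to leading order.\<close>
  define b where "b n = V n / (2 * sqrt (q n))" for n
  have lim_b: "(b \<longlongrightarrow> \<sigma>2 / sqrt D) F"
  proof -
    have "((\<lambda>n. (V n / n) / (2 * (sqrt (q n) / n))) \<longlongrightarrow> \<sigma>2 / (2 * (sqrt D / 2))) F"
      using D by (intro tendsto_intros lim_V lift[OF lim_r]) simp
    moreover have "eventually (\<lambda>n. (V n / n) / (2 * (sqrt (q n) / n)) = b n) F"
      by (rule F) (simp add: b_def)
    ultimately show ?thesis using Lim_transform_eventually by fastforce
  qed
  define \<mu> \<phi> where "\<mu> = mupar \<alpha> \<beta> \<gamma> \<delta>" and "\<phi> = phipar \<alpha> \<beta> \<gamma> \<delta>"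
  have \<mu>: "\<mu> = (1 - sqrt D) / 2" by (simp add: \<mu>_def mupar_def D_def)
  \<comment> \<open>With 1 - 2 mu = sqrt D the constant splits by origin: 1/2 from Y = (n + 1)/2 -
    X, the second term from sqrt q, the third from b.\<close>
  have \<phi>: "\<phi> = 1 / 2 - 1 / (2 * sqrt D) + \<sigma>2 / sqrt D"
    using D unfolding \<phi>_def phipar_def \<mu>_def[symmetric] \<sigma>2_def[symmetric] \<mu>
    by (simp add: field_simps)
  define e where "e n = Eseq \<alpha> \<beta> \<gamma> n" for n
  have e_sum: "e n = (\<Sum>x\<in>{0..n div 2}. P n x * real x)" for n
    by (simp add: e_def Eseq_def P_def mult.commute)
  have e_eq: "e n = (real n + 1) / 2 - E n" if "sum (P n) {0..n div 2} = 1" for n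
  proof -
    have "E n = (\<Sum>x\<in>{0..n div 2}. (real n + 1) / 2 * P n x - P n x * real x)"
      unfolding E_def y_def by (intro sum.cong refl) (simp add: algebra_simps)
    also have "\<dots> = (real n + 1) / 2 * sum (P n) {0..n div 2} - e n"
      by (simp only: sum_subtractf sum_distrib_left e_sum)
    finally show ?thesis using that by simp
  qed
  have lim_e: "((\<lambda>n. e n - (real n * \<mu> + \<phi>)) \<longlongrightarrow> 0) F"
  proof -
    have "((\<lambda>n. 1 / 2 - (sqrt (q n) - n * sqrt D / 2) + b n - \<phi>) \<longlongrightarrow>
        1 / 2 - 1 / (2 * sqrt D) + \<sigma>2 / sqrt D - \<phi>) F"
      by (intro tendsto_intros lim_b lift[OF lim_r2])
    moreover have "eventually (\<lambda>n. 1 / 2 - (sqrt (q n) - n * sqrt D / 2) + b n - \<phi> = e n - (real n * \<mu> + \<phi>)) F"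
    proof (rule F)
      fix n assume "n \<ge> 1" "\<alpha> * real n \<in> \<int>" "(\<alpha> + \<beta>) * real n \<in> \<int>" "(\<alpha> + \<gamma>) * real n \<in> \<int>"
      from main[OF this] have "e n = (real n + 1) / 2 - (sqrt (q n) - b n)"
        using e_eq[of n] by (simp add: b_def)
      then show "1 / 2 - (sqrt (q n) - n * sqrt D / 2) + b n - \<phi> = e n - (real n * \<mu> + \<phi>)"
        by (simp add: \<mu> field_simps)
    qed
    ultimately have "((\<lambda>n. e n - (real n * \<mu> + \<phi>)) \<longlongrightarrow> 1 / 2 - 1 / (2 * sqrt D) + \<sigma>2 / sqrt D - \<phi>) F"
      by (rule Lim_transform_eventually)
    then show ?thesis by (simp add: \<phi>)
  qed
  have sc: "(\<Sum>x\<in>I. P n x * ((real x - c) / sqrt (real n))\<^sup>2) = (\<Sum>x\<in>I. P n x * (real x - c)\<^sup>2) / n" for I n c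
    by (simp add: power_divide sum_divide_distrib)
  have lim_var: "((\<lambda>n. \<Sum>x\<in>{0..n div 2}. P n x * ((real x - e n) / sqrt (real n))\<^sup>2) \<longlongrightarrow> \<sigma>2) F"
  proof -
    \<comment> \<open>X and Y have the same variance V - b^2, and b^2 / n vanishes because b
      converges.\<close>
    have "((\<lambda>n. V n / n - (b n)\<^sup>2 * (1 / real n)) \<longlongrightarrow> \<sigma>2 - (\<sigma>2 / sqrt D)\<^sup>2 * 0) F"
      by (intro tendsto_intros lim_V lim_b lift[OF inv0])
    moreover have "eventually (\<lambda>n. V n / n - (b n)\<^sup>2 * (1 / real n) =
        (\<Sum>x\<in>{0..n div 2}. P n x * ((real x - e n) / sqrt (real n))\<^sup>2)) F"
    proof (rule F)
      fix n assume "n \<ge> 1" "\<alpha> * real n \<in> \<int>" "(\<alpha> + \<beta>) * real n \<in> \<int>" "(\<alpha> + \<gamma>) * real n \<in> \<int>"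
      note m = main[OF this]
      have "(\<Sum>x\<in>{0..n div 2}. P n x * (real x - e n)\<^sup>2) = (\<Sum>x\<in>{0..n div 2}. P n x * (y n x - E n)\<^sup>2)"
      proof (intro sum.cong refl)
        fix x
        have "real x - e n = - (y n x - E n)" using e_eq[of n] m by (simp add: y_def)
        then show "P n x * (real x - e n)\<^sup>2 = P n x * (y n x - E n)\<^sup>2" by (simp only: power2_minus)
      qed
      also have "\<dots> = V n - (E n - sqrt (q n))\<^sup>2"
        unfolding V_def E_def using m by (intro variance_shift) simp
      also have "E n - sqrt (q n) = - b n" using m by (simp add: b_def)
      finally show "V n / n - (b n)\<^sup>2 * (1 / real n) =
          (\<Sum>x\<in>{0..n div 2}. P n x * ((real x - e n) / sqrt (real n))\<^sup>2)"
        unfolding sc by (simp add: diff_divide_distrib)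
    qed
    ultimately show ?thesis using Lim_transform_eventually by fastforce
  qed
  have "((\<lambda>n. \<Sum>x\<in>{0..n div 2}. P n x * ((real x - real n * \<mu>) / sqrt (real n))\<^sup>2) \<longlongrightarrow> \<sigma>2) F"
  proof -
    \<comment> \<open>The bias e - n mu tends to phi, so its square disappears after division by
      n.\<close>
    have "((\<lambda>n. (\<Sum>x\<in>{0..n div 2}. P n x * ((real x - e n) / sqrt (real n))\<^sup>2)
        + ((e n - (real n * \<mu> + \<phi>)) + \<phi>)\<^sup>2 * (1 / real n)) \<longlongrightarrow> \<sigma>2 + (0 + \<phi>)\<^sup>2 * 0) F"
      by (intro tendsto_intros lim_var lim_e lift[OF inv0])
    moreover have "eventually (\<lambda>n. (\<Sum>x\<in>{0..n div 2}. P n x * ((real x - e n) / sqrt (real n))\<^sup>2)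
        + ((e n - (real n * \<mu> + \<phi>)) + \<phi>)\<^sup>2 * (1 / real n) =
        (\<Sum>x\<in>{0..n div 2}. P n x * ((real x - real n * \<mu>) / sqrt (real n))\<^sup>2)) F"
    proof (rule F)
      fix n assume "n \<ge> 1" "\<alpha> * real n \<in> \<int>" "(\<alpha> + \<beta>) * real n \<in> \<int>" "(\<alpha> + \<gamma>) * real n \<in> \<int>"
      from main[OF this] have "(\<Sum>x\<in>{0..n div 2}. P n x * (real x - e n)\<^sup>2) =
          (\<Sum>x\<in>{0..n div 2}. P n x * (real x - real n * \<mu>)\<^sup>2) - (e n - real n * \<mu>)\<^sup>2"
        unfolding e_sum by (intro variance_shift) simp
      then show "(\<Sum>x\<in>{0..n div 2}. P n x * ((real x - e n) / sqrt (real n))\<^sup>2)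
        + ((e n - (real n * \<mu> + \<phi>)) + \<phi>)\<^sup>2 * (1 / real n) =
        (\<Sum>x\<in>{0..n div 2}. P n x * ((real x - real n * \<mu>) / sqrt (real n))\<^sup>2)"
        unfolding sc by (simp add: diff_divide_distrib)
    qed
    ultimately show ?thesis using Lim_transform_eventually by fastforce
  qed
  with lim_var lim_e show ?thesis
    unfolding P_def e_def \<mu>_def \<phi>_def \<sigma>2_def by (simp add: diff_divide_distrib)
qed

end
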